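(* Let $1<P,Q<\infty$. There exist constants $0<k\le K<\infty$ depending only on $P,Q$ such that for every compact interval $J=[c,d]$, $c<d$, all finite nonnegative Borel measures $\mu,\nu$ on $J$, and every Borel measurable $\omega:J\to[0,\infty]$, $$k\,\mathfrak H_J\le\|H_\mu:L^P(\mu)\to L^Q(\nu)\|\le K\,\mathfrak H_J$$ and $$k\,\mathfrak C_{\omega,J}\le\|C_{\mu,\omega}:L^P(\mu)\to L^Q(\nu)\|\le K\,\mathfrak C_{\omega,J},$$ both in the extended sense (in $[0,\infty]$). Here $$\mathfrak H_J=\sup_{x\in J}M(x)^{1/P'}N(x)^{1/Q}\ \text{ if }P\le Q,\qquad \mathfrak H_J=\left[\int_JN(x)^{R/Q}\,d\!\left(M(x)^{R/P'}\right)\right]^{1/R}\ \text{ if }Q<P,$$ $$\mathfrak C_{\omega,J}=\sup_{x\in J}K(x)^{1/Q}B_\omega(x)^{1/P'}\ \text{ if }P\le Q,\qquad \mathfrak C_{\omega,J}=\left[\int_JB_\omega(x)^{R/P'}\,d\!\left(K(x)^{R/Q}\right)\right]^{1/R}\ \text{ if }Q<P,$$ where the function $K(x)$ is $\nu([c,x])$ (not the constant $K$), and the other functions are $M(x)=\mu([c,x])$, $N(x)=\nu([x,d])$, $B_\omega(x)=\int_{(x,d]}\omega(t)^{P'}d\mu(t)$, and $\frac1R=\frac1Q-\frac1P$ when $Q<P$. The Stieltjes measures include the left-boundary masses $M(c)^{R/P'}\delta_c$ and $K(c)^{R/Q}\delta_c$.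
   Context: $P'=P/(P-1)$. For Borel $h\ge0$ on $J$: the closed Hardy operator is $H_\mu h(x)=\int_{[c,x]}h\,d\mu$, and the strict weighted Copson operator is $C_{\mu,\omega}h(x)=\int_{(x,d]}\omega(t)h(t)\,d\mu(t)$, where for unbounded or infinite-valued $\omega$ this is the increasing limit as $m\to\infty$ of the same expression with $\omega$ replaced by $\omega\wedge m$ (so $0\cdot\infty=0$; the same convention is used for products such as $K(x)^{1/Q}B_\omega(x)^{1/P'}$). The norm $\|T:L^P(\mu)\to L^Q(\nu)\|\in[0,\infty]$ is the optimal constant in $\|Th\|_{L^Q(\nu)}\le C\|h\|_{L^P(\mu)}$ over $h\ge0$. Stieltjes convention: for $F:[c,d]\to[0,\infty)$ nondecreasing and right-continuous and $\gamma>0$, $d(F^\gamma)$ is the Borel measure on $[c,d]$ with $d(F^\gamma)([c,x])=F(x)^\gamma$ for all $x\in[c,d]$ ($F^\gamma$ extended by zero immediately to the left of $c$); in particular $d(F^\gamma)(\{c\})=F(c)^\gamma$. *)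

theory Defs
  imports "HOL-Analysis.Analysis"
begin

text \<open>A finite Borel measure on the compact interval \<open>[c,d]\<close>; its space is \<open>[c,d]\<close> itself.\<close>

definition finite_borel_measure_on :: "real \<Rightarrow> real \<Rightarrow> real measure \<Rightarrow> bool" where
  "finite_borel_measure_on c d \<mu> \<longleftrightarrow>
     finite_measure \<mu> \<and> sets \<mu> = sets (restrict_space borel {c..d})"

text \<open>Powers of extended nonnegative reals, only used with exponent \<open>p > 0\<close>; then
  \<open>epowr 0 p = 0\<close> and \<open>epowr \<infinity> p = \<infinity>\<close>.\<close>

definition epowr :: "ennreal \<Rightarrow> real \<Rightarrow> ennreal" where
  "epowr x p = (if x = \<infinity> then \<infinity> else ennreal (enn2real x powr p))"

definition conj_exponent :: "real \<Rightarrow> real" where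
  "conj_exponent P = P / (P - 1)"

text \<open>The exponent \<open>R\<close> with \<open>1/R = 1/Q - 1/P\<close>, only used for \<open>Q < P\<close>.\<close>

definition gap_exponent :: "real \<Rightarrow> real \<Rightarrow> real" where
  "gap_exponent P Q = 1 / (1 / Q - 1 / P)"

definition Lp_norm :: "real measure \<Rightarrow> real \<Rightarrow> (real \<Rightarrow> ennreal) \<Rightarrow> ennreal" where
  "Lp_norm \<mu> p f = epowr (\<integral>\<^sup>+ x. epowr (f x) p \<partial>\<mu>) (1 / p)"

text \<open>The optimal constant in \<open>[0,\<infinity>]\<close>. In particular it is \<open>\<infinity>\<close> if no finite constant works:
  the infimum of the empty set is \<open>\<infinity>\<close>.\<close>

definition opt_const ::
  "real measure \<Rightarrow> real \<Rightarrow> real measure \<Rightarrow> real \<Rightarrow>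
   ((real \<Rightarrow> ennreal) \<Rightarrow> real \<Rightarrow> ennreal) \<Rightarrow> ennreal" where
  "opt_const \<mu> P \<nu> Q T =
     Inf {C. \<forall>h \<in> borel_measurable \<mu>. Lp_norm \<nu> Q (T h) \<le> C * Lp_norm \<mu> P h}"

definition hardy_op :: "real \<Rightarrow> real measure \<Rightarrow> (real \<Rightarrow> ennreal) \<Rightarrow> real \<Rightarrow> ennreal" where
  "hardy_op c \<mu> h x = (\<integral>\<^sup>+ t \<in> {c..x}. h t \<partial>\<mu>)"

text \<open>The truncated expressions increase with \<open>m\<close>, so that their supremum is their limit; for
  bounded \<open>\<omega>\<close> they are eventually equal to the expression with \<open>\<omega>\<close> itself.\<close>

definition copson_op ::
  "real \<Rightarrow> real measure \<Rightarrow> (real \<Rightarrow> ennreal) \<Rightarrow> (real \<Rightarrow> ennreal) \<Rightarrow> real \<Rightarrow> ennreal" where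
  "copson_op d \<mu> \<omega> h x =
     (SUP m::nat. \<integral>\<^sup>+ t \<in> {x<..d}. min (\<omega> t) (of_nat m) * h t \<partial>\<mu>)"

text \<open>The Borel measure \<open>d(F\<^sup>\<gamma>)\<close> on \<open>[c,d]\<close>, for \<open>F\<close> nondecreasing and right-continuous on
  \<open>[c,d]\<close>: \<open>F\<close> is extended by zero to the left of \<open>c\<close> and by the constant \<open>F d\<close> to
  the right of \<open>d\<close>. See \<open>emeasure_stieltjes_power\<close> below for the mass of \<open>[c,x]\<close>.\<close>

definition stieltjes_power :: "real \<Rightarrow> real \<Rightarrow> (real \<Rightarrow> real) \<Rightarrow> real \<Rightarrow> real measure" where
  "stieltjes_power c d F \<gamma> =
     restrict_space
       (interval_measure (\<lambda>x. if x < c then 0 else F (min x d) powr \<gamma>)) {c..d}"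

lemma sets_stieltjes_power:
  "sets (stieltjes_power c d F \<gamma>) = sets (restrict_space borel {c..d})"
  unfolding stieltjes_power_def by (intro sets_restrict_space_cong) simp

lemma emeasure_stieltjes_power:
  assumes mono: "mono_on {c..d} F"
    and nonneg: "\<And>x. x \<in> {c..d} \<Longrightarrow> 0 \<le> F x"
    and right_cont: "\<And>x. x \<in> {c..<d} \<Longrightarrow> continuous (at_right x) F"
    and "\<gamma> > 0" "x \<in> {c..d}"
  shows "emeasure (stieltjes_power c d F \<gamma>) {c..x} = ennreal (F x powr \<gamma>)"
proof -
  define G where "G = (\<lambda>x. if x < c then 0 else F (min x d) powr \<gamma>)"
  have cd: "c \<le> d" using \<open>x \<in> {c..d}\<close> by auto
  have G_mono: "G a \<le> G b" if "a \<le> b" for a b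
  proof (cases "a < c")
    case False
    have "F (min a d) \<le> F (min b d)"
      using False that cd by (intro mono_onD[OF mono]) auto
    moreover have "0 \<le> F (min a d)" using False cd by (intro nonneg) auto
    ultimately show ?thesis
      using False that \<open>\<gamma> > 0\<close> by (auto simp: G_def intro!: powr_mono2)
  qed (auto simp: G_def)
  have G_cont: "continuous (at_right a) G" for a
  proof -
    consider "a < c" | "c \<le> a" "a < d" | "d \<le> a" "c \<le> a" using cd by linarith
    then show ?thesis
    proof cases
      case 1
      have "\<forall>\<^sub>F y in at_right a. G y = 0"
        using 1 by (auto simp: G_def eventually_at_right_field intro!: exI[of _ c])
      then have "(G \<longlongrightarrow> 0) (at_right a)"
        by (simp add: tendsto_eventually)
      then show ?thesis using 1 by (simp add: continuous_within G_def)
    next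
      case 2
      have ev: "\<forall>\<^sub>F y in at_right a. a < y \<and> y < d"
        using 2 by (auto simp: eventually_at_right_field)
      have "(F \<longlongrightarrow> F a) (at_right a)"
        using right_cont[of a] 2 by (simp add: continuous_within)
      moreover have "\<forall>\<^sub>F y in at_right a. 0 \<le> F y"
        using ev by eventually_elim (use 2 in \<open>auto intro: nonneg\<close>)
      ultimately have "((\<lambda>y. F y powr \<gamma>) \<longlongrightarrow> F a powr \<gamma>) (at_right a)"
        using \<open>\<gamma> > 0\<close> by (intro tendsto_powr2) auto
      moreover have "\<forall>\<^sub>F y in at_right a. F y powr \<gamma> = G y"
        using ev by eventually_elim (use 2 in \<open>auto simp: G_def\<close>)
      ultimately have "(G \<longlongrightarrow> F a powr \<gamma>) (at_right a)"
        by (rule Lim_transform_eventually)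
      then show ?thesis using 2 by (simp add: continuous_within G_def)
    next
      case 3
      have "\<forall>\<^sub>F y in at_right a. G y = F d powr \<gamma>"
        using 3 by (auto simp: G_def eventually_at_right_field min_def intro!: exI[of _ "a + 1"])
      then have "(G \<longlongrightarrow> F d powr \<gamma>) (at_right a)"
        by (simp add: tendsto_eventually)
      moreover have "G a = F d powr \<gamma>"
        using 3 by (simp add: G_def min_absorb2)
      ultimately show ?thesis by (simp add: continuous_within)
    qed
  qed
  let ?I = "interval_measure G"
  have Ioc: "emeasure ?I {a<..x} = ennreal (F x powr \<gamma>)" if "a < c" for a
    using emeasure_interval_measure_Ioc[of a x G, OF _ G_mono G_cont] that \<open>x \<in> {c..d}\<close>
    by (auto simp: G_def)
  have null: "emeasure ?I {a<..<c} = 0" if "a < c" for a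
  proof -
    have "emeasure ?I {a<..<c} = emeasure ?I (\<Union>n. {a<..c - (c - a) / (real n + 1)})"
    proof (intro arg_cong2[where f = emeasure] refl set_eqI iffI)
      fix y assume y: "y \<in> {a<..<c}"
      obtain n where n: "(c - a) / (c - y) < real n"
        using reals_Archimedean2 by blast
      have "(c - a) / (real n + 1) \<le> c - y"
      proof -
        have "c - a < real n * (c - y)" using n y by (simp add: field_simps)
        then have "c - a \<le> (c - y) * (real n + 1)" using y by (simp add: algebra_simps)
        then show ?thesis by (simp add: pos_divide_le_eq)
      qed
      then show "y \<in> (\<Union>n. {a<..c - (c - a) / (real n + 1)})"
        using y by (auto intro!: exI[of _ n])
    next
      fix y assume "y \<in> (\<Union>n. {a<..c - (c - a) / (real n + 1)})"
      then obtain n where n: "a < y" "y \<le> c - (c - a) / (real n + 1)" by auto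
      moreover have "(c - a) / (real n + 1) > 0" using that by simp
      ultimately show "y \<in> {a<..<c}" by auto
    qed
    also have "\<dots> = 0"
    proof (rule emeasure_UN_eq_0)
      fix n :: nat
      have "a \<le> c - (c - a) / (real n + 1)" "c - (c - a) / (real n + 1) < c"
        using that by (auto simp: field_simps mult_right_mono)
      then show "emeasure ?I {a<..c - (c - a) / (real n + 1)} = 0"
        using emeasure_interval_measure_Ioc[of a _ G, OF _ G_mono G_cont] that
        by (auto simp: G_def)
    qed auto
    finally show ?thesis .
  qed
  have "emeasure (stieltjes_power c d F \<gamma>) {c..x} = emeasure ?I {c..x}"
    unfolding stieltjes_power_def G_def
    using \<open>x \<in> {c..d}\<close> by (intro emeasure_restrict_space) auto
  also have "\<dots> = emeasure ?I {c - 1<..<c} + emeasure ?I {c..x}"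
    by (simp add: null)
  also have "\<dots> = emeasure ?I ({c - 1<..<c} \<union> {c..x})"
    by (intro plus_emeasure) auto
  also have "{c - 1<..<c} \<union> {c..x} = {c - 1<..x}"
    using \<open>x \<in> {c..d}\<close> by auto
  also have "emeasure ?I \<dots> = ennreal (F x powr \<gamma>)"
    by (intro Ioc) simp
  finally show ?thesis .
qed

definition hardy_const ::
  "real \<Rightarrow> real \<Rightarrow> real \<Rightarrow> real \<Rightarrow> real measure \<Rightarrow> real measure \<Rightarrow> ennreal" where
  "hardy_const P Q c d \<mu> \<nu> =
     (let P' = conj_exponent P; R = gap_exponent P Q;
          M = (\<lambda>x. measure \<mu> {c..x}); N = (\<lambda>x. measure \<nu> {x..d})
      in if P \<le> Q
         then (SUP x \<in> {c..d}. ennreal (M x powr (1 / P') * N x powr (1 / Q)))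
         else epowr (\<integral>\<^sup>+ x. ennreal (N x powr (R / Q)) \<partial>stieltjes_power c d M (R / P')) (1 / R))"

text \<open>The weight and hence \<open>B\<close> may be infinite; the product in the first case uses the
  library convention \<open>0 * \<infinity> = 0\<close>.\<close>

definition copson_const ::
  "real \<Rightarrow> real \<Rightarrow> real \<Rightarrow> real \<Rightarrow> real measure \<Rightarrow> real measure \<Rightarrow> (real \<Rightarrow> ennreal) \<Rightarrow> ennreal" where
  "copson_const P Q c d \<mu> \<nu> \<omega> =
     (let P' = conj_exponent P; R = gap_exponent P Q;
          K = (\<lambda>x. measure \<nu> {c..x});
          B = (\<lambda>x. \<integral>\<^sup>+ t \<in> {x<..d}. epowr (\<omega> t) P' \<partial>\<mu>)
      in if P \<le> Q
         then (SUP x \<in> {c..d}. ennreal (K x powr (1 / Q)) * epowr (B x) (1 / P'))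
         else epowr (\<integral>\<^sup>+ x. epowr (B x) (R / P') \<partial>stieltjes_power c d K (R / Q)) (1 / R))"

end

theory Submission
  imports Defs "HOL-Probability.Distribution_Functions"
begin

text \<open>
  Both operators are instances of one weighted Hardy operator
  \<open>Hh(x) = \<integral>\<^bsub>{t. t \<lhd> x}\<^esub> h d\<mu>\<close>, where \<open>t \<lhd> x\<close> is \<open>t \<le> x\<close> or
  \<open>t < x\<close> and the target measure is \<open>\<nu>\<close> with an arbitrary density \<open>w\<close>. The Hardy operator is
  the case of \<open>\<le>\<close> and \<open>w = 1\<close>. The Copson operator is the transpose of
  \<open>g \<mapsto> \<omega>(t) \<integral>\<^bsub>{x. x < t}\<^esub> g d\<nu>\<close>, so by duality it has the norm of the weighted Hardy operator
  from \<open>L\<^sup>p(\<nu>)\<close> to \<open>L\<^sup>q(\<omega>\<^sup>q d\<mu>)\<close> with \<open>p = Q'\<close>, \<open>q = P'\<close>. Since \<open>1/q - 1/p = 1/Q - 1/P\<close>, the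
  test quantity of that operator is exactly the one claimed for the Copson operator.

  The analysis of \<open>H\<close> rests on one property of a distribution function
  \<open>G(t) = \<integral>\<^bsub>{s. s \<le> t}\<^esub> h d\<mu>\<close>: the measure \<open>h d\<mu>\<close> gives at most mass \<open>s\<close> to \<open>{G \<le> s}\<close>
  (\<open>cumul_sublevel\<close>). Hence on a set of \<open>h d\<mu>\<close>-mass \<open>F\<close> at least half of the mass sees \<open>G > F/2\<close>,
  and so \<open>F\<^sup>Q \<le> 2\<^sup>Q \<integral> G\<^bsup>Q-1\<^esup> h d\<mu>\<close> over that set (\<open>epowr_nn_integral_le\<close>). Atoms cause no trouble,
  and no substitution formula is needed. Applied to \<open>{t. t \<lhd> x}\<close> and integrated in \<open>x\<close>, this
  and its trivial converse show that, up to the factor \<open>2\<^sup>Q\<close>,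
    \<open>\<integral> w (Hh)\<^sup>Q d\<nu>\<close> is \<open>\<integral> G\<^bsup>Q-1\<^esup> h N d\<mu>\<close>, where \<open>N(t) = \<integral>\<^bsub>{x. t \<lhd> x}\<^esub> w d\<nu>\<close>.

  Write \<open>G = A M\<close> with the distribution function \<open>M\<close> of \<open>\<mu>\<close> and the average \<open>A\<close> of \<open>h\<close> over
  \<open>{s. s \<le> t}\<close>. The averages are bounded on \<open>L\<^sup>P(\<mu>)\<close> for every \<open>\<mu>\<close> (\<open>nn_integral_avg_le\<close>), again by
  the power inequality. Then the upper bounds are short. If \<open>P \<le> Q\<close>, the hypothesis bounds
  \<open>M\<^bsup>Q/P'\<^esup> N\<close>, and the surplus power \<open>A\<^bsup>Q-P\<^esup>\<close> is absorbed by \<open>A \<le> \<parallel>h\<parallel> M\<^bsup>-1/P\<^esup>\<close>. If \<open>Q < P\<close>, Hoelder's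
  inequality with exponents \<open>P/Q\<close> and \<open>R/Q\<close> separates \<open>A\<^bsup>Q-1\<^esup> h \<le> A\<^sup>Q + h\<^sup>Q\<close> from \<open>M\<^bsup>Q-1\<^esup> N\<close> and leaves
  \<open>I = \<integral> N\<^bsup>R/Q\<^esup> M\<^bsup>R/Q'\<^esup> d\<mu>\<close>. The lower bounds come from \<open>h = 1\<close> on \<open>{s. s \<le> t}\<close> and, for \<open>Q < P\<close>, from
  \<open>h = N\<^bsup>R/(PQ)\<^esup> M\<^bsup>R/(PQ')\<^esup>\<close>, for which \<open>\<integral> h\<^sup>P d\<mu> = I\<close>.

  Finally \<open>R/Q' = R/P' - 1\<close>, so \<open>I\<close> integrates \<open>N\<^bsup>R/Q\<^esup>\<close> against \<open>M\<^bsup>\<gamma>-1\<^esup> d\<mu>\<close> with \<open>\<gamma> = R/P'\<close>. By the power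
  inequality this measure and \<open>d(M\<^sup>\<gamma>)\<close> are comparable on initial intervals, which is enough for
  integrals of the antitone function \<open>N\<^bsup>R/Q\<^esup>\<close> (\<open>nn_integral_antimono_le\<close>).
\<close>

section \<open>Powers of extended nonnegative reals\<close>

text \<open>The values \<open>0\<close> at \<open>0\<close> and \<open>\<infinity>\<close> at \<open>\<infinity>\<close>, which \<open>epowr\<close> takes for every real exponent, make the
  algebraic laws below unconditional, negative exponents included. In particular
  \<open>epowr x (- 1)\<close> is a reciprocal that vanishes at \<open>0\<close>, which is the right convention for averages
  over null sets.\<close>

lemma epowr_0 [simp]: "epowr 0 a = 0"
  by (simp add: epowr_def)

lemma epowr_top [simp]: "epowr \<infinity> a = \<infinity>" "epowr top a = top"
  by (simp_all add: epowr_def)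

lemma epowr_ennreal: "0 \<le> x \<Longrightarrow> epowr (ennreal x) a = ennreal (x powr a)"
  by (simp add: epowr_def)

lemma epowr_one [simp]: "epowr x 1 = x" "epowr 1 a = 1"
  by (simp_all add: epowr_def top.not_eq_extremum)

lemma epowr_eq_0_iff [simp]: "epowr x a = 0 \<longleftrightarrow> x = 0"
  by (cases x) (auto simp: epowr_ennreal ennreal_eq_0_iff)

lemma epowr_eq_top_iff [simp]: "epowr x a = top \<longleftrightarrow> x = top"
  by (cases x) (auto simp: epowr_ennreal)

lemma epowr_add: "epowr x (a + b) = epowr x a * epowr x b"
  by (cases x) (auto simp: epowr_ennreal powr_add ennreal_mult ennreal_top_mult)

lemma epowr_mult: "epowr (x * y) a = epowr x a * epowr y a"
proof (cases x)
  case (real r)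
  then show ?thesis
    by (cases y)
      (auto simp: epowr_ennreal powr_mult simp flip: ennreal_mult,
       auto simp: ennreal_mult_top epowr_ennreal)
next
  case top
  then show ?thesis by (cases y) (auto simp: ennreal_top_mult epowr_ennreal)
qed

lemma epowr_epowr [simp]: "epowr (epowr x a) b = epowr x (a * b)"
  by (cases x) (auto simp: epowr_ennreal powr_powr)

lemma epowr_mono:
  assumes "x \<le> y" "0 \<le> a"
  shows "epowr x a \<le> epowr y a"
proof (cases y)
  case (real s)
  then obtain r where "x = ennreal r" "0 \<le> r" "r \<le> s"
    using assms(1) by (cases x) (auto simp: top_unique)
  then show ?thesis
    using real assms(2) by (simp add: epowr_ennreal powr_mono2 ennreal_leI)
qed simp

lemma epowr_mult_minus: "0 < x \<Longrightarrow> x < top \<Longrightarrow> epowr x a * epowr x (- a) = 1"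
  by (cases x) (auto simp: epowr_ennreal powr_minus simp flip: ennreal_mult)

lemma epowr_mult_minus_le_1: "x < top \<Longrightarrow> epowr x a * epowr x (- a) \<le> 1"
  by (cases "x = 0") (auto simp: epowr_mult_minus zero_less_iff_neq_zero)

lemma epowr_less_top [simp]: "epowr x a < top \<longleftrightarrow> x < top"
  by (metis epowr_eq_top_iff top.not_eq_extremum)

lemma borel_measurable_epowr [measurable]: "(\<lambda>x. epowr x a) \<in> borel_measurable borel"
  unfolding epowr_def by measurable

lemma le_epowr_iff:
  assumes "0 < a"
  shows "epowr x a \<le> y \<longleftrightarrow> x \<le> epowr y (1 / a)"
proof
  assume "epowr x a \<le> y"
  from epowr_mono[OF this, of "1/a"] show "x \<le> epowr y (1 / a)" using assms by simp
next
  assume "x \<le> epowr y (1 / a)"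
  from epowr_mono[OF this, of a] show "epowr x a \<le> y" using assms by simp
qed

text \<open>Continuity from below follows from the Galois connection between \<open>x \<mapsto> x\<^sup>a\<close> and its inverse.\<close>
lemma epowr_SUP:
  assumes "0 < a"
  shows "epowr (SUP i\<in>I. f i) a = (SUP i\<in>I. epowr (f i) a)"
proof (rule antisym)
  show "epowr (SUP i\<in>I. f i) a \<le> (SUP i\<in>I. epowr (f i) a)"
    unfolding le_epowr_iff[OF assms]
    by (intro SUP_least) (auto simp flip: le_epowr_iff[OF assms] intro: SUP_upper)
  show "(SUP i\<in>I. epowr (f i) a) \<le> epowr (SUP i\<in>I. f i) a"
    using assms by (intro SUP_least epowr_mono SUP_upper) auto
qed

text \<open>The final step of every bootstrapping argument below: a finite quantity bounded by a smaller power
  of itself.\<close>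
lemma epowr_cancel:
  assumes "X \<le> Y * epowr X a" "X < top"
  shows "epowr X (1 - a) \<le> Y"
proof -
  have "epowr X (1 - a) = X * epowr X (- a)"
    using epowr_add[of X 1 "- a"] by simp
  also have "\<dots> \<le> Y * (epowr X a * epowr X (- a))"
    using mult_right_mono[OF assms(1), of "epowr X (- a)"] by (simp add: mult.assoc)
  also have "\<dots> \<le> Y"
    using mult_left_mono[OF epowr_mult_minus_le_1[OF assms(2), of a], of Y] by simp
  finally show ?thesis .
qed

text \<open>Replace the smaller of \<open>a\<close> and \<open>b\<close> by the larger one.\<close>
lemma epowr_mult_le_add:
  assumes "1 \<le> q"
  shows "epowr a (q - 1) * b \<le> epowr a q + epowr b q"
proof (cases "a \<le> b")
  case True
  then have "epowr a (q - 1) * b \<le> epowr b (q - 1) * epowr b 1"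
    using assms by (auto intro!: mult_right_mono epowr_mono)
  also have "\<dots> = epowr b q" using epowr_add[of b "q - 1" 1] by simp
  finally show ?thesis by (simp add: add_increasing)
next
  case False
  then have "epowr a (q - 1) * b \<le> epowr a (q - 1) * epowr a 1"
    by (auto intro!: mult_left_mono)
  also have "\<dots> = epowr a q" using epowr_add[of a "q - 1" 1] by simp
  finally show ?thesis by (simp add: add_increasing2)
qed

lemma SUP_min_of_nat: "(SUP n::nat. min x (of_nat n)) = (x::ennreal)"
proof (rule antisym)
  show "x \<le> (SUP n::nat. min x (of_nat n))"
  proof (cases x)
    case (real r)
    obtain n :: nat where "r \<le> real n" using real_arch_simple by blast
    then have "x \<le> min x (of_nat n)"
      using real by (simp add: ennreal_of_nat_eq_real_of_nat ennreal_leI)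
    then show ?thesis by (rule SUP_upper2[OF UNIV_I])
  next
    case top
    then show ?thesis by (simp add: min_def top_unique ennreal_SUP_of_nat_eq_top)
  qed
qed (auto intro: SUP_least)

lemma inverse_gap_exponent: "1 / gap_exponent P Q = 1 / Q - 1 / P"
  by (simp add: gap_exponent_def)

lemma gap_exponent_unique:
  fixes P Q R :: real
  assumes "1 / R = 1 / Q - 1 / P" "1 < Q" "Q < P"
  shows "R = P * Q / (P - Q)"
proof -
  have "R = 1 / (1 / Q - 1 / P)" by (simp flip: assms(1))
  then show ?thesis using assms(2,3) by (simp add: field_simps)
qed

section \<open>Inequalities of Young and Hoelder\<close>

lemma Young_epowr:
  assumes "1 < p" "1 / p + 1 / q = 1" "0 < a" "0 < b"
  shows "x * y \<le> ennreal (a * b) *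
    (epowr x p * ennreal (1 / (p * a powr p)) + epowr y q * ennreal (1 / (q * b powr q)))"
proof -
  have q: "1 < q"
    using assms(1,2) by (smt (verit) divide_less_eq_1_pos zero_less_divide_1_iff)
  have pos: "0 < 1 / (p * a powr p)" "0 < 1 / (q * b powr q)" "0 < a * b"
    using assms q by auto
  consider "x = top \<or> y = top" | r s where "x = ennreal r" "y = ennreal s" "0 \<le> r" "0 \<le> s"
    by (cases x; cases y) auto
  then show ?thesis
  proof cases
    case 1
    then show ?thesis using pos by (auto simp: ennreal_mult_top ennreal_top_mult)
  next
    case 2
    have "(r / a) * (s / b) \<le> (r / a) powr p / p + (s / b) powr q / q"
      using assms q 2 by (intro Youngs_inequality) auto
    then have "r * s \<le> a * b * (r powr p * (1 / (p * a powr p)) + s powr q * (1 / (q * b powr q)))"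
      using assms 2 by (simp add: field_simps powr_divide)
    then show ?thesis
      using 2 pos
      by (simp add: epowr_ennreal flip: ennreal_mult ennreal_plus del: times_divide_eq_right)
  qed
qed

text \<open>Integrate Young's inequality after scaling \<open>f\<close> and \<open>g\<close> to norm one.\<close>
lemma Holder_nn_integral:
  assumes "1 < p" "1 / p + 1 / q = 1"
    and [measurable]: "f \<in> borel_measurable M" "g \<in> borel_measurable M"
  shows "(\<integral>\<^sup>+x. f x * g x \<partial>M)
    \<le> epowr (\<integral>\<^sup>+x. epowr (f x) p \<partial>M) (1 / p) * epowr (\<integral>\<^sup>+x. epowr (g x) q \<partial>M) (1 / q)"
    (is "?L \<le> epowr ?F _ * epowr ?G _")
proof -
  have q: "1 < q"
    using assms(1,2) by (smt (verit) divide_less_eq_1_pos zero_less_divide_1_iff)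
  consider "?F = 0 \<or> ?G = 0" | "?F \<noteq> 0" "?G \<noteq> 0" "?F = top \<or> ?G = top" |
     F G where "?F = ennreal F" "?G = ennreal G" "0 < F" "0 < G"
    by (cases ?F; cases ?G) (auto simp: less_le)
  then show ?thesis
  proof cases
    case 1
    then have "(AE x in M. epowr (f x) p = 0) \<or> (AE x in M. epowr (g x) q = 0)"
      by (subst (asm) (1 2) nn_integral_0_iff_AE) auto
    then have "AE x in M. f x * g x = 0" by auto
    then have "?L = 0" by (subst nn_integral_0_iff_AE) auto
    then show ?thesis by simp
  next
    case 2
    then have "epowr ?F (1 / p) * epowr ?G (1 / q) = top"
      by (auto simp: ennreal_mult_eq_top_iff)
    then show ?thesis by simp
  next
    case 3
    define a where "a = F powr (1 / p)"
    define b where "b = G powr (1 / q)"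
    have ab: "0 < a" "0 < b" "a powr p = F" "b powr q = G"
      using 3 assms q by (auto simp: a_def b_def powr_powr)
    have "?L \<le> (\<integral>\<^sup>+x. ennreal (a * b) *
        (epowr (f x) p * ennreal (1 / (p * F)) + epowr (g x) q * ennreal (1 / (q * G))) \<partial>M)"
      using Young_epowr[OF assms(1,2) ab(1,2)] ab(3,4) by (intro nn_integral_mono) simp
    also have "\<dots> = ennreal (a * b) * (ennreal F * ennreal (1 / (p * F)) + ennreal G * ennreal (1 / (q * G)))"
      using 3 by (simp add: nn_integral_cmult nn_integral_add nn_integral_multc)
    also have "ennreal F * ennreal (1 / (p * F)) + ennreal G * ennreal (1 / (q * G)) = ennreal (1 / p + 1 / q)"
      using 3 assms q by (simp flip: ennreal_mult ennreal_plus)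
    also have "ennreal (a * b) * \<dots> = epowr ?F (1 / p) * epowr ?G (1 / q)"
      using 3 ab assms(2) by (simp add: epowr_ennreal a_def b_def ennreal_mult)
    finally show ?thesis .
  qed
qed

section \<open>Distribution functions of measures on the line\<close>

text \<open>An initial segment of the line may lack a greatest element. The sequence then makes it
  accessible to continuity from below.\<close>
lemma cofinal_sequence:
  fixes D :: "real set"
  assumes "D \<noteq> {}"
  obtains t :: "nat \<Rightarrow> real" where "incseq t" "range t \<subseteq> D" "\<forall>x\<in>D. \<exists>n. x \<le> t n"
proof (cases "\<exists>a\<in>D. \<forall>x\<in>D. x \<le> a")
  case True
  then obtain a where "a \<in> D" "\<forall>x\<in>D. x \<le> a" by auto
  then show thesis by (intro that[of "\<lambda>_. a"]) (auto simp: incseq_def)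
next
  case no_max: False
  obtain f where f: "incseq f" "range f \<subseteq> ereal ` D" "Sup (ereal ` D) = (SUP i. f i)"
    using Sup_countable_SUP[of "ereal ` D"] assms by auto
  then have "\<forall>n. \<exists>t\<in>D. f n = ereal t" by auto
  then obtain t where t: "\<And>n. t n \<in> D" "\<And>n. f n = ereal (t n)" by metis
  show thesis
  proof (rule that[of t])
    show "incseq t" using f(1) t(2) by (auto simp: incseq_def)
    show "range t \<subseteq> D" using t(1) by auto
    show "\<forall>x\<in>D. \<exists>n. x \<le> t n"
    proof
      fix x assume "x \<in> D"
      then obtain y where "y \<in> D" "x < y" using no_max by force
      then have "ereal x < Sup (ereal ` D)"
        by (auto simp: less_Sup_iff)
      then show "\<exists>n. x \<le> t n"
        using t(2) by (auto simp: f(3) less_SUP_iff intro: less_imp_le)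
    qed
  qed
qed

definition cumul :: "real measure \<Rightarrow> (real \<Rightarrow> ennreal) \<Rightarrow> real \<Rightarrow> ennreal" where
  "cumul M h t = (\<integral>\<^sup>+ s \<in> {..t}. h s \<partial>M)"

lemma cumul_mono: "s \<le> t \<Longrightarrow> cumul M h s \<le> cumul M h t"
  unfolding cumul_def by (intro nn_integral_mono) (auto split: split_indicator)

lemma measurable_indicator_atMost [measurable (raw)]:
  fixes f g :: "'a \<Rightarrow> real"
  assumes [measurable]: "f \<in> borel_measurable M" "g \<in> borel_measurable M"
  shows "(\<lambda>x. indicator {..g x} (f x) :: ennreal) \<in> borel_measurable M"
  unfolding indicator_def atMost_iff by measurable

lemma measurable_indicator_atLeast [measurable (raw)]:
  fixes f g :: "'a \<Rightarrow> real"
  assumes [measurable]: "f \<in> borel_measurable M" "g \<in> borel_measurable M"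
  shows "(\<lambda>x. indicator {g x..} (f x) :: ennreal) \<in> borel_measurable M"
  unfolding indicator_def atLeast_iff by measurable

text \<open>The \<open>P\<close>-th power of \<open>2\<^sup>P P'\<close>: the factor \<open>2\<^sup>P\<close> is the loss in the power inequality, and
  \<open>P' = 1 + 1/(P-1)\<close> is the constant of the tail integral of \<open>mass\<^bsup>-P\<^esup>\<close>.\<close>
definition avg_bound :: "real \<Rightarrow> real" where
  "avg_bound P = (2 powr P * (P / (P - 1))) powr P"

lemma avg_bound_nonneg [simp]: "0 \<le> avg_bound P"
  by (simp add: avg_bound_def)

text \<open>The space may be any subset of the line, so that measures whose space is a compact interval
  are covered without extending them.\<close>
locale real_line_measure = finite_measure M for M :: "real measure" +
  assumes ident_measurable [measurable]: "(\<lambda>x. x) \<in> borel_measurable M"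
begin

lemma measurable_cumul [measurable]:
  assumes [measurable]: "h \<in> borel_measurable M"
  shows "cumul M h \<in> borel_measurable borel"
proof -
  have [measurable]: "(\<lambda>p. snd p) \<in> borel_measurable (borel \<Otimes>\<^sub>M M)"
    using measurable_compose[OF measurable_snd ident_measurable] .
  show ?thesis unfolding cumul_def by measurable
qed

lemma measurable_cumul' [measurable]:
  "h \<in> borel_measurable M \<Longrightarrow> cumul M h \<in> borel_measurable M"
  using measurable_compose[OF ident_measurable measurable_cumul] .

text \<open>The sublevel set is an initial segment, hence an increasing limit of segments \<open>{..t n}\<close> with end
  points in it. Each of them has \<open>h d\<mu>\<close>-mass at most \<open>s\<close> by the definition of the set. An atom
  cannot spoil this, because it is counted in the distribution function at its own position.\<close>
lemma cumul_sublevel: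
  assumes [measurable]: "h \<in> borel_measurable M"
  shows "(\<integral>\<^sup>+ t \<in> {t. cumul M h t \<le> s}. h t \<partial>M) \<le> s"
proof (cases "{t. cumul M h t \<le> s} = {}")
  case False
  then obtain t :: "nat \<Rightarrow> real" where t: "incseq t" "range t \<subseteq> {t. cumul M h t \<le> s}"
    and cof: "\<forall>x\<in>{t. cumul M h t \<le> s}. \<exists>n. x \<le> t n"
    by (rule cofinal_sequence)
  have "(\<integral>\<^sup>+ x \<in> {t. cumul M h t \<le> s}. h x \<partial>M) \<le> (\<integral>\<^sup>+ x. (SUP n. h x * indicator {..t n} x) \<partial>M)"
  proof (intro nn_integral_mono)
    fix x
    show "h x * indicator {t. cumul M h t \<le> s} x \<le> (SUP n. h x * indicator {..t n} x)"
    proof (cases "cumul M h x \<le> s")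
      case True
      then obtain n where "x \<le> t n" using cof by auto
      then show ?thesis by (intro SUP_upper2[of n]) (auto split: split_indicator)
    qed simp
  qed
  also have "\<dots> = (SUP n. cumul M h (t n))"
    unfolding cumul_def using t(1)
    by (intro nn_integral_monotone_convergence_SUP)
       (auto simp: incseq_def le_fun_def split: split_indicator intro: order_trans)
  also have "\<dots> \<le> s" using t(2) by (intro SUP_least) auto
  finally show ?thesis .
qed simp

text \<open>By \<open>cumul_sublevel\<close> at least half of the mass \<open>F\<close> of \<open>A\<close> lies where the distribution function
  exceeds \<open>F/2\<close>. This replaces the formula \<open>\<integral> G\<^sup>p dG = G\<^bsup>p+1\<^esup> / (p + 1)\<close> for continuous \<open>G\<close>.\<close>
lemma epowr_nn_integral_le:
  assumes [measurable]: "h \<in> borel_measurable M" "Measurable.pred M (\<lambda>t. t \<in> A)" and p: "0 \<le> p"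
  shows "epowr (\<integral>\<^sup>+ t \<in> A. h t \<partial>M) (p + 1)
    \<le> ennreal (2 powr (p + 1)) * (\<integral>\<^sup>+ t \<in> A. epowr (cumul M h t) p * h t \<partial>M)"
    (is "epowr ?F _ \<le> _ * ?R")
proof -
  define X where "X s = (\<integral>\<^sup>+ t. h t * indicator A t * indicator {t. s < cumul M h t} t \<partial>M)" for s
  have split: "?F \<le> s + X s" for s
  proof -
    have "?F \<le> (\<integral>\<^sup>+ t. h t * indicator {t. cumul M h t \<le> s} t
        + h t * indicator A t * indicator {t. s < cumul M h t} t \<partial>M)"
      by (intro nn_integral_mono) (auto split: split_indicator)
    also have "\<dots> = (\<integral>\<^sup>+ t \<in> {t. cumul M h t \<le> s}. h t \<partial>M) + X s"
      unfolding X_def by (subst nn_integral_add) auto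
    also have "\<dots> \<le> s + X s"
      by (intro add_right_mono cumul_sublevel) auto
    finally show ?thesis .
  qed
  have power: "epowr s p * X s \<le> ?R" for s
  proof -
    have "epowr s p * X s
        = (\<integral>\<^sup>+ t. epowr s p * (h t * indicator A t * indicator {t. s < cumul M h t} t) \<partial>M)"
      unfolding X_def by (subst nn_integral_cmult) auto
    also have "\<dots> \<le> ?R"
      using p by (intro nn_integral_mono)
        (auto split: split_indicator intro!: mult_right_mono epowr_mono)
    finally show ?thesis .
  qed
  show ?thesis
  proof (cases ?F)
    case top
    \<comment> \<open>For infinite \<open>F\<close> any positive finite level will do.\<close>
    then have "X 1 = top" using split[of 1] by (simp add: top_unique ennreal_add_eq_top)
    then have "?R = top" using power[of 1] by (simp add: top_unique)
    then show ?thesis by (simp add: ennreal_mult_top)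
  next
    case (real F)
    have "ennreal F \<le> ennreal (F / 2) + X (ennreal (F / 2))"
      using split[of "ennreal (F / 2)"] real by simp
    then have X: "ennreal (F / 2) \<le> X (ennreal (F / 2))"
      by (cases "X (ennreal (F / 2))") (use real in \<open>auto simp flip: ennreal_plus\<close>)
    have "epowr ?F (p + 1) = ennreal (2 powr (p + 1)) * epowr (ennreal (F / 2)) (p + 1)"
      using real by (simp add: epowr_ennreal powr_divide flip: ennreal_mult)
    also have "epowr (ennreal (F / 2)) (p + 1) \<le> epowr (ennreal (F / 2)) p * X (ennreal (F / 2))"
      unfolding epowr_add using X by (intro mult_left_mono) auto
    also have "\<dots> \<le> ?R" by (rule power)
    finally show ?thesis by (simp add: mult_left_mono)
  qed
qed

abbreviation mass :: "real \<Rightarrow> ennreal" where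
  "mass \<equiv> cumul M (\<lambda>_. 1)"

lemma mass_less_top: "mass t < top"
proof -
  have "mass t \<le> (\<integral>\<^sup>+ s. 1 \<partial>M)"
    unfolding cumul_def by (intro nn_integral_mono) (auto split: split_indicator)
  also have "\<dots> < top" by (simp add: less_top[symmetric])
  finally show ?thesis .
qed

text \<open>Write the negative power of \<open>mass x\<close> as an integral of \<open>k(u) = (p + 1) u\<^bsup>-p-2\<^esup>\<close> over \<open>u \<ge> mass x\<close>
  and exchange the integrals: the inner one is then the mass of a sublevel set, which is at
  most \<open>u\<close>.\<close>
lemma nn_integral_mass_tail:
  assumes "0 < p" "0 < mass t"
  shows "(\<integral>\<^sup>+ x \<in> {t..}. epowr (mass x) (- (p + 1)) \<partial>M) \<le> ennreal (1 + 1 / p) * epowr (mass t) (- p)"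
proof -
  interpret pair_sigma_finite M lborel
    by (simp add: pair_sigma_finite_def sigma_finite_measure_axioms sigma_finite_lborel)
  obtain m where m: "mass t = ennreal m" "0 < m"
    using assms(2) mass_less_top[of t] by (cases "mass t") auto
  have power: "(\<integral>\<^sup>+ u. ennreal (a * u powr (- (a + 1))) * indicator {r..} u \<partial>lborel) = ennreal (r powr (- a))"
    if "0 < a" "0 < r" for a r :: real
  proof -
    have "((\<lambda>u. - (u powr (- a))) \<longlongrightarrow> - 0) at_top"
      using that by (intro tendsto_minus tendsto_neg_powr filterlim_ident) auto
    then have "(\<integral>\<^sup>+ u. ennreal (a * u powr (- (a + 1))) * indicator {r..} u \<partial>lborel)
        = ennreal (0 - - (r powr (- a)))"
      using that by (intro nn_integral_FTC_atLeast)
        (auto intro!: derivative_eq_intros simp: powr_diff powr_minus field_simps powr_add)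
    then show ?thesis by simp
  qed
  define k where "k u = (p + 1) * u powr (- (p + 1 + 1))" for u :: real
  have [measurable]: "k \<in> borel_measurable borel" unfolding k_def by measurable
  have "(\<integral>\<^sup>+ x \<in> {t..}. epowr (mass x) (- (p + 1)) \<partial>M)
      \<le> (\<integral>\<^sup>+ x. \<integral>\<^sup>+ u. ennreal (k u) * indicator {m..} u * indicator {x. mass x \<le> ennreal u} x \<partial>lborel \<partial>M)"
  proof (intro nn_integral_mono)
    fix x
    show "epowr (mass x) (- (p + 1)) * indicator {t..} x
      \<le> (\<integral>\<^sup>+ u. ennreal (k u) * indicator {m..} u * indicator {x. mass x \<le> ennreal u} x \<partial>lborel)"
    proof (cases "t \<le> x")
      case True
      then have "ennreal m \<le> mass x" using cumul_mono[of t x] m(1) by metis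
      then obtain r where r: "mass x = ennreal r" "m \<le> r"
        using mass_less_top[of x] m(2) by (cases "mass x") auto
      have "epowr (mass x) (- (p + 1)) = (\<integral>\<^sup>+ u. ennreal (k u) * indicator {r..} u \<partial>lborel)"
        unfolding k_def using r m assms by (subst power) (auto simp: epowr_ennreal)
      also have "\<dots> \<le> (\<integral>\<^sup>+ u. ennreal (k u) * indicator {m..} u * indicator {x. mass x \<le> ennreal u} x \<partial>lborel)"
        using r m by (intro nn_integral_mono) (auto split: split_indicator intro: ennreal_leI)
      finally show ?thesis by (simp add: True)
    qed simp
  qed
  also have "\<dots> = (\<integral>\<^sup>+ u. \<integral>\<^sup>+ x. ennreal (k u) * indicator {m..} u * indicator {x. mass x \<le> ennreal u} x \<partial>M \<partial>lborel)"
    by (rule Fubini'[symmetric]) (simp add: indicator_def)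
  also have "\<dots> \<le> (\<integral>\<^sup>+ u. ennreal (k u * u) * indicator {m..} u \<partial>lborel)"
  proof (intro nn_integral_mono)
    fix u
    have "(\<integral>\<^sup>+ x. ennreal (k u) * indicator {m..} u * indicator {x. mass x \<le> ennreal u} x \<partial>M)
        = ennreal (k u) * indicator {m..} u * (\<integral>\<^sup>+ x \<in> {x. mass x \<le> ennreal u}. 1 \<partial>M)"
      by (subst nn_integral_cmult) auto
    also have "\<dots> \<le> ennreal (k u) * indicator {m..} u * ennreal u"
      by (intro mult_left_mono cumul_sublevel) auto
    also have "\<dots> = ennreal (k u * u) * indicator {m..} u"
      using m assms by (auto split: split_indicator simp: ennreal_mult k_def)
    finally show "(\<integral>\<^sup>+ x. ennreal (k u) * indicator {m..} u * indicator {x. mass x \<le> ennreal u} x \<partial>M)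
      \<le> ennreal (k u * u) * indicator {m..} u" .
  qed
  also have "\<dots> = (\<integral>\<^sup>+ u. ennreal (1 + 1 / p) * (ennreal (p * u powr (- (p + 1))) * indicator {m..} u) \<partial>lborel)"
  proof (intro nn_integral_cong)
    fix u
    have k: "k u * u = (1 + 1 / p) * (p * u powr (- (p + 1)))" if "m \<le> u"
    proof -
      have "u powr (- (p + 1 + 1)) * u = u powr (- (p + 1))"
        using that m powr_add[of u "- (p + 1 + 1)" 1] by (simp add: algebra_simps)
      then have "k u * u = (p + 1) * u powr (- (p + 1))" by (simp add: k_def mult.assoc)
      also have "\<dots> = (1 + 1 / p) * (p * u powr (- (p + 1)))"
        using assms(1) by (simp add: distrib_right)
      finally show ?thesis .
    qed
    have pos: "0 \<le> 1 + 1 / p" "0 \<le> p * u powr (- (p + 1))" using assms(1) by auto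
    show "ennreal (k u * u) * indicator {m..} u
      = ennreal (1 + 1 / p) * (ennreal (p * u powr (- (p + 1))) * indicator {m..} u)"
    proof (cases "m \<le> u")
      case True
      then show ?thesis by (simp only: k ennreal_mult[OF pos] mult.assoc)
    qed simp
  qed
  also have "\<dots> = ennreal (1 + 1 / p) * ennreal (m powr (- p))"
    using assms m power[of p m] by (subst nn_integral_cmult) auto
  also have "\<dots> = ennreal (1 + 1 / p) * epowr (mass t) (- p)"
    using m by (simp add: epowr_ennreal)
  finally show ?thesis .
qed

section \<open>Averages over initial segments\<close>

definition avg :: "(real \<Rightarrow> ennreal) \<Rightarrow> real \<Rightarrow> ennreal" where
  "avg h t = cumul M h t * epowr (mass t) (- 1)"

lemma measurable_avg [measurable]:
  assumes [measurable]: "h \<in> borel_measurable M"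
  shows "avg h \<in> borel_measurable M"
  unfolding avg_def by measurable

lemma cumul_eq_0:
  assumes "mass t = 0" "h \<in> borel_measurable M"
  shows "cumul M h t = 0"
proof -
  have "AE s in M. indicator {..t} s = (0::ennreal)"
    using assms(1) unfolding cumul_def by (subst (asm) nn_integral_0_iff_AE) auto
  then have "AE s in M. h s * indicator {..t} s = 0" by auto
  then show ?thesis
    unfolding cumul_def using assms(2) by (subst nn_integral_0_iff_AE) auto
qed

lemma cumul_eq_avg:
  assumes "h \<in> borel_measurable M"
  shows "cumul M h t = avg h t * mass t"
proof (cases "mass t = 0")
  case False
  then have "epowr (mass t) (- 1) * mass t = 1"
    using epowr_mult_minus[of "mass t" 1] mass_less_top[of t]
    by (simp add: zero_less_iff_neq_zero mult.commute)
  then show ?thesis by (simp add: avg_def mult.assoc)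
qed (simp add: cumul_eq_0 assms)

text \<open>The power inequality and an exchange of integrals bound the integral of the \<open>P\<close>-th power of the
  averages by that of \<open>avg\<^bsup>P-1\<^esup> h\<close>; Hoelder's inequality then bounds it by its own power
  \<open>1 - 1/P\<close>. Boundedness of \<open>h\<close> makes it finite, so that this power can be cancelled.\<close>
lemma nn_integral_avg_le_bounded:
  assumes [measurable]: "h \<in> borel_measurable M" and P: "1 < P" and bound: "\<And>t. h t \<le> of_nat n"
  shows "(\<integral>\<^sup>+ t. epowr (avg h t) P \<partial>M)
    \<le> ennreal (avg_bound P) * (\<integral>\<^sup>+ t. epowr (h t) P \<partial>M)"
    (is "?J \<le> _ * ?H")
proof -
  interpret pair_sigma_finite M M
    by (simp add: pair_sigma_finite_def sigma_finite_measure_axioms)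
  have [measurable]: "(\<lambda>p. fst p) \<in> borel_measurable (M \<Otimes>\<^sub>M M)" "(\<lambda>p. snd p) \<in> borel_measurable (M \<Otimes>\<^sub>M M)"
    using measurable_compose[OF measurable_fst ident_measurable]
      measurable_compose[OF measurable_snd ident_measurable] by auto
  have "avg h t \<le> of_nat n" for t
  proof -
    have "cumul M h t \<le> (\<integral>\<^sup>+ s. of_nat n * (1 * indicator {..t} s) \<partial>M)"
      unfolding cumul_def using bound by (intro nn_integral_mono) (auto split: split_indicator)
    also have "\<dots> = of_nat n * mass t"
      unfolding cumul_def by (subst nn_integral_cmult) auto
    finally have "avg h t \<le> of_nat n * (epowr (mass t) 1 * epowr (mass t) (- 1))"
      unfolding avg_def by (simp add: mult_right_mono flip: mult.assoc)
    also have "\<dots> \<le> of_nat n * 1"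
      by (intro mult_left_mono epowr_mult_minus_le_1 mass_less_top) auto
    finally show ?thesis by simp
  qed
  then have "?J \<le> (\<integral>\<^sup>+ t. epowr (of_nat n) P \<partial>M)"
    using P by (intro nn_integral_mono epowr_mono) auto
  also have "\<dots> < top"
    by (simp add: less_top[symmetric] ennreal_mult_eq_top_iff)
  finally have fin: "?J < top" .
  have "?J \<le> (\<integral>\<^sup>+ x. ennreal (2 powr P) * (\<integral>\<^sup>+ t. epowr (cumul M h t) (P - 1) * h t
          * (indicator {..x} t * epowr (mass x) (- P)) \<partial>M) \<partial>M)"
  proof (intro nn_integral_mono)
    fix x
    have "epowr (avg h x) P = epowr (cumul M h x) (P - 1 + 1) * epowr (mass x) (- P)"
      by (simp add: avg_def epowr_mult)
    also have "epowr (cumul M h x) (P - 1 + 1) \<le> ennreal (2 powr (P - 1 + 1)) *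
        (\<integral>\<^sup>+ t \<in> {..x}. epowr (cumul M h t) (P - 1) * h t \<partial>M)"
      unfolding cumul_def[of M h x] using P by (intro epowr_nn_integral_le) auto
    also have "\<dots> * epowr (mass x) (- P) = ennreal (2 powr P) * (\<integral>\<^sup>+ t. epowr (cumul M h t) (P - 1) * h t
          * (indicator {..x} t * epowr (mass x) (- P)) \<partial>M)"
      by (simp add: mult.assoc flip: nn_integral_multc)
    finally show "epowr (avg h x) P \<le> ennreal (2 powr P) * (\<integral>\<^sup>+ t. epowr (cumul M h t) (P - 1) * h t
          * (indicator {..x} t * epowr (mass x) (- P)) \<partial>M)"
      by (simp add: mult_right_mono)
  qed
  also have "\<dots> = ennreal (2 powr P) * (\<integral>\<^sup>+ x. \<integral>\<^sup>+ t. epowr (cumul M h t) (P - 1) * h t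
          * (indicator {..x} t * epowr (mass x) (- P)) \<partial>M \<partial>M)"
    by (subst nn_integral_cmult) auto
  also have "(\<integral>\<^sup>+ x. \<integral>\<^sup>+ t. epowr (cumul M h t) (P - 1) * h t
          * (indicator {..x} t * epowr (mass x) (- P)) \<partial>M \<partial>M)
      = (\<integral>\<^sup>+ t. \<integral>\<^sup>+ x. epowr (cumul M h t) (P - 1) * h t
          * (indicator {..x} t * epowr (mass x) (- P)) \<partial>M \<partial>M)"
    by (rule Fubini') measurable
  also have "\<dots> \<le> (\<integral>\<^sup>+ t. ennreal (P / (P - 1)) * (epowr (avg h t) (P - 1) * h t) \<partial>M)"
  proof (intro nn_integral_mono)
    fix t
    have "(\<integral>\<^sup>+ x. epowr (cumul M h t) (P - 1) * h t * (indicator {..x} t * epowr (mass x) (- P)) \<partial>M)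
        = epowr (cumul M h t) (P - 1) * h t * (\<integral>\<^sup>+ x \<in> {t..}. epowr (mass x) (- (P - 1 + 1)) \<partial>M)"
      by (subst nn_integral_cmult[symmetric])
        (auto intro!: nn_integral_cong split: split_indicator)
    also have "\<dots> \<le> epowr (cumul M h t) (P - 1) * h t * (ennreal (1 + 1 / (P - 1)) * epowr (mass t) (- (P - 1)))"
    proof (cases "mass t = 0")
      case False
      then show ?thesis
        using P by (intro mult_left_mono nn_integral_mass_tail) (auto simp: zero_less_iff_neq_zero)
    qed (simp add: cumul_eq_0)
    also have "\<dots> = ennreal (P / (P - 1)) * (epowr (avg h t) (P - 1) * h t)"
    proof -
      have "1 + 1 / (P - 1) = P / (P - 1)" using P by (simp add: field_simps)
      then show ?thesis by (simp add: avg_def epowr_mult mult_ac)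
    qed
    finally show "(\<integral>\<^sup>+ x. epowr (cumul M h t) (P - 1) * h t * (indicator {..x} t * epowr (mass x) (- P)) \<partial>M)
        \<le> ennreal (P / (P - 1)) * (epowr (avg h t) (P - 1) * h t)" .
  qed
  also have "\<dots> = ennreal (P / (P - 1)) * (\<integral>\<^sup>+ t. epowr (avg h t) (P - 1) * h t \<partial>M)"
    by (subst nn_integral_cmult) auto
  also have "(\<integral>\<^sup>+ t. epowr (avg h t) (P - 1) * h t \<partial>M) \<le> epowr ?J (1 - 1 / P) * epowr ?H (1 / P)"
  proof -
    have "1 < P / (P - 1)" "(P - 1) / P = 1 - 1 / P" "(P - 1) * (P / (P - 1)) = P"
      using P by (auto simp: field_simps)
    then show ?thesis
      using Holder_nn_integral[of "P / (P - 1)" P "\<lambda>t. epowr (avg h t) (P - 1)" M h] P by simp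
  qed
  finally have "?J \<le> ennreal (2 powr P) *
      (ennreal (P / (P - 1)) * (epowr ?J (1 - 1 / P) * epowr ?H (1 / P)))"
    by (simp add: mult_left_mono)
  also have "\<dots> = ennreal (2 powr P * (P / (P - 1))) * epowr ?H (1 / P) * epowr ?J (1 - 1 / P)"
    using P by (subst ennreal_mult) (auto simp: mult_ac)
  finally have "?J \<le> ennreal (2 powr P * (P / (P - 1))) * epowr ?H (1 / P) * epowr ?J (1 - 1 / P)" .
  from epowr_cancel[OF this fin]
  have "epowr ?J (1 / P) \<le> ennreal (2 powr P * (P / (P - 1))) * epowr ?H (1 / P)" by simp
  then have "epowr (epowr ?J (1 / P)) P \<le> epowr (ennreal (2 powr P * (P / (P - 1))) * epowr ?H (1 / P)) P"
    using P by (intro epowr_mono) auto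
  then show ?thesis using P by (simp add: epowr_mult epowr_ennreal avg_bound_def)
qed

text \<open>Monotone convergence along \<open>min h n \<up> h\<close>.\<close>
lemma nn_integral_avg_le:
  assumes [measurable]: "h \<in> borel_measurable M" and P: "1 < P"
  shows "(\<integral>\<^sup>+ t. epowr (avg h t) P \<partial>M)
    \<le> ennreal (avg_bound P) * (\<integral>\<^sup>+ t. epowr (h t) P \<partial>M)"
proof -
  define f where "f n t = min (h t) (of_nat n)" for n t
  have [measurable]: "f n \<in> borel_measurable M" for n unfolding f_def by measurable
  have f_mono: "f m t \<le> f n t" if "m \<le> n" for m n t
    unfolding f_def using that by (intro min.mono) (auto simp: of_nat_mono)
  have "cumul M h t = (SUP n. cumul M (f n) t)" for t
  proof -
    have "cumul M h t = (\<integral>\<^sup>+ s. (SUP n. f n s * indicator {..t} s) \<partial>M)"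
      unfolding cumul_def f_def by (simp add: SUP_min_of_nat flip: SUP_mult_right_ennreal)
    also have "\<dots> = (SUP n. cumul M (f n) t)"
      unfolding cumul_def
      by (intro nn_integral_monotone_convergence_SUP)
         (auto simp: incseq_def le_fun_def intro!: mult_right_mono f_mono)
    finally show ?thesis .
  qed
  then have "epowr (avg h t) P = (SUP n. epowr (avg (f n) t) P)" for t
    using P by (simp add: avg_def SUP_mult_right_ennreal epowr_SUP)
  then have "(\<integral>\<^sup>+ t. epowr (avg h t) P \<partial>M) = (\<integral>\<^sup>+ t. (SUP n. epowr (avg (f n) t) P) \<partial>M)"
    by simp
  also have "\<dots> = (SUP n. \<integral>\<^sup>+ t. epowr (avg (f n) t) P \<partial>M)"
    using P unfolding avg_def cumul_def
    by (intro nn_integral_monotone_convergence_SUP)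
       (auto simp: incseq_def le_fun_def intro!: epowr_mono mult_right_mono f_mono nn_integral_mono)
  also have "\<dots> \<le> (SUP n. ennreal (avg_bound P) * (\<integral>\<^sup>+ t. epowr (f n t) P \<partial>M))"
    by (intro SUP_mono' nn_integral_avg_le_bounded[OF _ P, where h = "f n" and n = n for n])
       (auto simp: f_def)
  also have "\<dots> \<le> ennreal (avg_bound P) * (\<integral>\<^sup>+ t. epowr (h t) P \<partial>M)"
    using P by (intro SUP_least mult_left_mono nn_integral_mono epowr_mono) (auto simp: f_def)
  finally show ?thesis .
qed

end

section \<open>The weighted Hardy operator\<close>

text \<open>The relation stands for \<open>\<le>\<close> or \<open><\<close>. Integrating \<open>w\<close> against a finite measure, instead of
  using the density measure, admits infinite weights while keeping Tonelli's theorem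
  available.\<close>
locale weighted_hardy = real_line_measure M + target: real_line_measure N
  for M N :: "real measure" +
  fixes w :: "real \<Rightarrow> ennreal" and rel :: "real \<Rightarrow> real \<Rightarrow> bool" (infix "\<lhd>" 50)
  assumes w_measurable [measurable]: "w \<in> borel_measurable N"
    and rel_measurable: "Measurable.pred (borel \<Otimes>\<^sub>M borel) (\<lambda>p. fst p \<lhd> snd p)"
    and rel_down: "s \<le> t \<Longrightarrow> t \<lhd> x \<Longrightarrow> s \<lhd> x"
begin

lemma pred_rel:
  assumes [measurable]: "f \<in> borel_measurable K" "g \<in> borel_measurable K"
  shows "Measurable.pred K (\<lambda>x. f x \<lhd> g x)"
proof -
  have "(\<lambda>x. (f x, g x)) \<in> K \<rightarrow>\<^sub>M borel \<Otimes>\<^sub>M borel" by measurable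
  from measurable_compose[OF this rel_measurable] show ?thesis by simp
qed

lemma measurable_indicator_rel [measurable (raw)]:
  assumes "f \<in> borel_measurable K" "g \<in> borel_measurable K"
  shows "(\<lambda>x. indicator {t. t \<lhd> g x} (f x) :: ennreal) \<in> borel_measurable K"
    and "(\<lambda>x. indicator {y. f x \<lhd> y} (g x) :: ennreal) \<in> borel_measurable K"
proof -
  have [measurable]: "Measurable.pred K (\<lambda>x. f x \<lhd> g x)" using assms by (rule pred_rel)
  show "(\<lambda>x. indicator {t. t \<lhd> g x} (f x) :: ennreal) \<in> borel_measurable K"
    unfolding indicator_def mem_Collect_eq by measurable
  show "(\<lambda>x. indicator {y. f x \<lhd> y} (g x) :: ennreal) \<in> borel_measurable K"
    unfolding indicator_def mem_Collect_eq by measurable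
qed

definition hardy :: "(real \<Rightarrow> ennreal) \<Rightarrow> real \<Rightarrow> ennreal" where
  "hardy h x = (\<integral>\<^sup>+ t \<in> {t. t \<lhd> x}. h t \<partial>M)"

definition tail :: "real \<Rightarrow> ennreal" where
  "tail t = (\<integral>\<^sup>+ x \<in> {x. t \<lhd> x}. w x \<partial>N)"

lemma tail_antimono: "s \<le> t \<Longrightarrow> tail t \<le> tail s"
  unfolding tail_def
  by (intro nn_integral_mono) (auto split: split_indicator intro: rel_down)

lemma measurable_pair [measurable]:
  "(\<lambda>p. fst p) \<in> borel_measurable (M \<Otimes>\<^sub>M N)" "(\<lambda>p. snd p) \<in> borel_measurable (M \<Otimes>\<^sub>M N)"
  "(\<lambda>p. fst p) \<in> borel_measurable (N \<Otimes>\<^sub>M M)" "(\<lambda>p. snd p) \<in> borel_measurable (N \<Otimes>\<^sub>M M)"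
  using measurable_compose[OF measurable_fst ident_measurable]
    measurable_compose[OF measurable_snd ident_measurable]
    measurable_compose[OF measurable_fst target.ident_measurable]
    measurable_compose[OF measurable_snd target.ident_measurable] by auto

lemma measurable_hardy [measurable]:
  assumes [measurable]: "h \<in> borel_measurable M"
  shows "hardy h \<in> borel_measurable N"
  unfolding hardy_def by measurable

lemma measurable_tail [measurable]: "tail \<in> borel_measurable M"
  unfolding tail_def by measurable

lemma nn_integral_rel_swap:
  assumes [measurable]: "f \<in> borel_measurable M" "u \<in> borel_measurable N"
  shows "(\<integral>\<^sup>+ x. u x * (\<integral>\<^sup>+ t \<in> {t. t \<lhd> x}. f t \<partial>M) \<partial>N)
    = (\<integral>\<^sup>+ t. f t * (\<integral>\<^sup>+ x \<in> {x. t \<lhd> x}. u x \<partial>N) \<partial>M)"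
proof -
  interpret pair_sigma_finite M N
    by (simp add: pair_sigma_finite_def sigma_finite_measure_axioms
        target.sigma_finite_measure_axioms)
  have "(\<integral>\<^sup>+ x. u x * (\<integral>\<^sup>+ t \<in> {t. t \<lhd> x}. f t \<partial>M) \<partial>N)
      = (\<integral>\<^sup>+ x. \<integral>\<^sup>+ t. f t * (u x * indicator {t. t \<lhd> x} t) \<partial>M \<partial>N)"
    by (simp add: mult_ac flip: nn_integral_cmult)
  also have "\<dots> = (\<integral>\<^sup>+ t. \<integral>\<^sup>+ x. f t * (u x * indicator {t. t \<lhd> x} t) \<partial>N \<partial>M)"
    by (rule Fubini') measurable
  also have "\<dots> = (\<integral>\<^sup>+ t. f t * (\<integral>\<^sup>+ x \<in> {x. t \<lhd> x}. u x \<partial>N) \<partial>M)"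
  proof (intro nn_integral_cong)
    fix t
    have "f t * (\<integral>\<^sup>+ x \<in> {x. t \<lhd> x}. u x \<partial>N) = (\<integral>\<^sup>+ x. f t * (u x * indicator {x. t \<lhd> x} x) \<partial>N)"
      by (subst nn_integral_cmult) auto
    then show "(\<integral>\<^sup>+ x. f t * (u x * indicator {t. t \<lhd> x} t) \<partial>N) = f t * (\<integral>\<^sup>+ x \<in> {x. t \<lhd> x}. u x \<partial>N)"
      by (simp add: indicator_def)
  qed
  finally show ?thesis .
qed

text \<open>This lemma and the next turn the norm of \<open>Hh\<close> into an integral with respect to the source measure,
  in which the target measure enters only through its tail.\<close>
lemma hardy_power_le:
  assumes [measurable]: "h \<in> borel_measurable M" and Q: "1 \<le> Q"
  shows "(\<integral>\<^sup>+ x. w x * epowr (hardy h x) Q \<partial>N)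
    \<le> ennreal (2 powr Q) * (\<integral>\<^sup>+ t. epowr (cumul M h t) (Q - 1) * h t * tail t \<partial>M)"
proof -
  have "(\<integral>\<^sup>+ x. w x * epowr (hardy h x) Q \<partial>N)
      \<le> (\<integral>\<^sup>+ x. ennreal (2 powr Q) *
          (w x * (\<integral>\<^sup>+ t \<in> {t. t \<lhd> x}. epowr (cumul M h t) (Q - 1) * h t \<partial>M)) \<partial>N)"
  proof (intro nn_integral_mono)
    fix x
    have [measurable, simp]: "Measurable.pred M (\<lambda>t. t \<lhd> x)"
      using pred_rel[OF ident_measurable, of "\<lambda>_. x"] by simp
    have "epowr (hardy h x) (Q - 1 + 1) \<le> ennreal (2 powr (Q - 1 + 1)) *
        (\<integral>\<^sup>+ t \<in> {t. t \<lhd> x}. epowr (cumul M h t) (Q - 1) * h t \<partial>M)"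
      unfolding hardy_def using Q by (intro epowr_nn_integral_le) auto
    from mult_left_mono[OF this, of "w x"]
    show "w x * epowr (hardy h x) Q \<le> ennreal (2 powr Q) *
        (w x * (\<integral>\<^sup>+ t \<in> {t. t \<lhd> x}. epowr (cumul M h t) (Q - 1) * h t \<partial>M))"
      by (simp add: mult_ac)
  qed
  also have "\<dots> = ennreal (2 powr Q) *
      (\<integral>\<^sup>+ x. w x * (\<integral>\<^sup>+ t \<in> {t. t \<lhd> x}. epowr (cumul M h t) (Q - 1) * h t \<partial>M) \<partial>N)"
    by (subst nn_integral_cmult) auto
  also have "(\<integral>\<^sup>+ x. w x * (\<integral>\<^sup>+ t \<in> {t. t \<lhd> x}. epowr (cumul M h t) (Q - 1) * h t \<partial>M) \<partial>N)
      = (\<integral>\<^sup>+ t. epowr (cumul M h t) (Q - 1) * h t * tail t \<partial>M)"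
    unfolding tail_def by (rule nn_integral_rel_swap) measurable
  finally show ?thesis .
qed

text \<open>For \<open>t \<lhd> x\<close> the operator at \<open>x\<close> integrates over a set that contains \<open>{..t}\<close>, so it dominates
  the distribution function at \<open>t\<close>, also for the strict relation.\<close>
lemma hardy_power_ge:
  assumes [measurable]: "h \<in> borel_measurable M" and Q: "1 \<le> Q"
  shows "(\<integral>\<^sup>+ t. epowr (cumul M h t) (Q - 1) * h t * tail t \<partial>M)
    \<le> (\<integral>\<^sup>+ x. w x * epowr (hardy h x) Q \<partial>N)"
proof -
  have "(\<integral>\<^sup>+ t. epowr (cumul M h t) (Q - 1) * h t * tail t \<partial>M)
      = (\<integral>\<^sup>+ x. w x * (\<integral>\<^sup>+ t \<in> {t. t \<lhd> x}. epowr (cumul M h t) (Q - 1) * h t \<partial>M) \<partial>N)"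
    unfolding tail_def by (rule nn_integral_rel_swap[symmetric]) measurable
  also have "\<dots> \<le> (\<integral>\<^sup>+ x. w x * epowr (hardy h x) Q \<partial>N)"
  proof (intro nn_integral_mono mult_left_mono)
    fix x
    have "cumul M h t \<le> hardy h x" if "t \<lhd> x" for t
      unfolding cumul_def hardy_def using rel_down[OF _ that]
      by (intro nn_integral_mono) (auto split: split_indicator)
    then have "(\<integral>\<^sup>+ t \<in> {t. t \<lhd> x}. epowr (cumul M h t) (Q - 1) * h t \<partial>M)
        \<le> (\<integral>\<^sup>+ t. epowr (hardy h x) (Q - 1) * (h t * indicator {t. t \<lhd> x} t) \<partial>M)"
      using Q by (intro nn_integral_mono)
        (auto split: split_indicator intro!: mult_right_mono epowr_mono)
    also have "\<dots> = epowr (hardy h x) (Q - 1) * hardy h x"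
      by (subst nn_integral_cmult) (auto simp: hardy_def)
    also have "\<dots> = epowr (hardy h x) Q"
      using epowr_add[of "hardy h x" "Q - 1" 1] by simp
    finally show "(\<integral>\<^sup>+ t \<in> {t. t \<lhd> x}. epowr (cumul M h t) (Q - 1) * h t \<partial>M) \<le> epowr (hardy h x) Q" .
  qed auto
  finally show ?thesis .
qed

lemma nn_integral_avg_times_le:
  assumes [measurable]: "h \<in> borel_measurable M" and P: "1 < P"
  shows "(\<integral>\<^sup>+ t. epowr (avg h t) (P - 1) * h t \<partial>M)
    \<le> ennreal (avg_bound P + 1) * (\<integral>\<^sup>+ t. epowr (h t) P \<partial>M)"
proof -
  have "(\<integral>\<^sup>+ t. epowr (avg h t) (P - 1) * h t \<partial>M)
      \<le> (\<integral>\<^sup>+ t. epowr (avg h t) P + epowr (h t) P \<partial>M)"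
    using P by (intro nn_integral_mono epowr_mult_le_add) auto
  also have "\<dots> = (\<integral>\<^sup>+ t. epowr (avg h t) P \<partial>M) + (\<integral>\<^sup>+ t. epowr (h t) P \<partial>M)"
    by (intro nn_integral_add) auto
  also have "\<dots> \<le> ennreal (avg_bound P) * (\<integral>\<^sup>+ t. epowr (h t) P \<partial>M) + (\<integral>\<^sup>+ t. epowr (h t) P \<partial>M)"
    by (intro add_right_mono nn_integral_avg_le P) auto
  also have "\<dots> = ennreal (avg_bound P + 1) * (\<integral>\<^sup>+ t. epowr (h t) P \<partial>M)"
    by (simp add: distrib_right)
  finally show ?thesis .
qed

text \<open>The exponents of \<open>mass\<close> split as \<open>Q - 1 = (Q - P)/P + (1 - 1/P) Q\<close>. The second part combines with
  the tail to \<open>C\<^sup>Q\<close>. The first cancels against \<open>avg\<^bsup>Q-P\<^esup>\<close>, because Hoelder's inequality gives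
  \<open>avg \<le> \<parallel>h\<parallel> mass\<^bsup>-1/P\<^esup>\<close>. What remains is the diagonal case \<open>avg\<^bsup>P-1\<^esup> h\<close>.\<close>
lemma hardy_upper_le:
  assumes [measurable]: "h \<in> borel_measurable M" and P: "1 < P" "P \<le> Q"
    and C: "\<And>t. t \<in> space M \<Longrightarrow> epowr (mass t) (1 - 1 / P) * epowr (tail t) (1 / Q) \<le> C"
  shows "(\<integral>\<^sup>+ x. w x * epowr (hardy h x) Q \<partial>N)
    \<le> ennreal (2 powr Q * (avg_bound P + 1)) * epowr C Q * epowr (\<integral>\<^sup>+ t. epowr (h t) P \<partial>M) (Q / P)"
proof -
  define H where "H = (\<integral>\<^sup>+ t. epowr (h t) P \<partial>M)"
  have avg_le: "avg h t \<le> epowr H (1 / P) * epowr (mass t) (- (1 / P))" for t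
  proof -
    have eq: "epowr (h s * indicator {..t} s) P = epowr (h s) P * indicator {..t} s"
      "epowr (indicator {..t} s) (P / (P - 1)) = indicator {..t} s" for s
      by (auto split: split_indicator)
    have "cumul M h t = (\<integral>\<^sup>+ s. h s * indicator {..t} s * indicator {..t} s \<partial>M)"
      unfolding cumul_def by (intro nn_integral_cong) (auto split: split_indicator)
    also have "\<dots> \<le> epowr (\<integral>\<^sup>+ s. epowr (h s * indicator {..t} s) P \<partial>M) (1 / P)
        * epowr (\<integral>\<^sup>+ s. epowr (indicator {..t} s) (P / (P - 1)) \<partial>M) (1 / (P / (P - 1)))"
      using P by (intro Holder_nn_integral) (auto simp: field_simps)
    also have "\<dots> = epowr (\<integral>\<^sup>+ s. epowr (h s) P * indicator {..t} s \<partial>M) (1 / P)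
        * epowr (mass t) (1 - 1 / P)"
      using P by (simp add: eq cumul_def field_simps)
    also have "\<dots> \<le> epowr H (1 / P) * epowr (mass t) (1 - 1 / P)"
      unfolding H_def using P
      by (intro mult_right_mono epowr_mono nn_integral_mono) (auto split: split_indicator)
    finally have "avg h t \<le> epowr H (1 / P) * (epowr (mass t) (1 - 1 / P) * epowr (mass t) (- 1))"
      unfolding avg_def by (simp add: mult_right_mono flip: mult.assoc)
    then show ?thesis by (simp flip: epowr_add)
  qed
  have pointwise: "epowr (cumul M h t) (Q - 1) * h t * tail t
      \<le> epowr C Q * epowr H ((Q - P) / P) * (epowr (avg h t) (P - 1) * h t)" if "t \<in> space M" for t
  proof -
    have "epowr (cumul M h t) (Q - 1) = epowr (avg h t) (P - 1) * epowr (avg h t) (Q - P) * epowr (mass t) (Q - 1)"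
      by (simp add: cumul_eq_avg[OF assms(1)] epowr_mult flip: epowr_add)
    also have "epowr (mass t) (Q - 1) = epowr (mass t) ((Q - P) / P) * epowr (mass t) ((1 - 1 / P) * Q)"
    proof -
      have eq: "Q - 1 = (Q - P) / P + (1 - 1 / P) * Q" using P by (simp add: field_simps)
      show ?thesis by (subst eq) (rule epowr_add)
    qed
    finally have "epowr (cumul M h t) (Q - 1) * h t * tail t
        = (epowr (avg h t) (P - 1) * h t) * (epowr (avg h t) (Q - P) * epowr (mass t) ((Q - P) / P))
          * (epowr (mass t) ((1 - 1 / P) * Q) * tail t)"
      by (simp add: mult_ac)
    also have "epowr (mass t) ((1 - 1 / P) * Q) * tail t
        = epowr (epowr (mass t) (1 - 1 / P) * epowr (tail t) (1 / Q)) Q"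
      using P by (simp add: epowr_mult)
    also have "\<dots> \<le> epowr C Q"
      using P C[OF that] by (intro epowr_mono) auto
    also have "epowr (avg h t) (Q - P) * epowr (mass t) ((Q - P) / P)
        \<le> epowr (epowr H (1 / P) * epowr (mass t) (- (1 / P))) (Q - P) * epowr (mass t) ((Q - P) / P)"
      using P avg_le by (intro mult_right_mono epowr_mono) auto
    also have "\<dots> = epowr H ((Q - P) / P) * (epowr (mass t) ((Q - P) / P) * epowr (mass t) (- ((Q - P) / P)))"
      by (simp add: epowr_mult mult_ac)
    also have "\<dots> \<le> epowr H ((Q - P) / P) * 1"
      by (intro mult_left_mono epowr_mult_minus_le_1 mass_less_top) auto
    finally show ?thesis by (simp add: mult_left_mono mult_right_mono mult_ac)
  qed
  have "(\<integral>\<^sup>+ x. w x * epowr (hardy h x) Q \<partial>N)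
      \<le> ennreal (2 powr Q) * (\<integral>\<^sup>+ t. epowr (cumul M h t) (Q - 1) * h t * tail t \<partial>M)"
    using P by (intro hardy_power_le) auto
  also have "(\<integral>\<^sup>+ t. epowr (cumul M h t) (Q - 1) * h t * tail t \<partial>M)
      \<le> (\<integral>\<^sup>+ t. epowr C Q * epowr H ((Q - P) / P) * (epowr (avg h t) (P - 1) * h t) \<partial>M)"
    by (intro nn_integral_mono pointwise)
  also have "\<dots> = epowr C Q * epowr H ((Q - P) / P) * (\<integral>\<^sup>+ t. epowr (avg h t) (P - 1) * h t \<partial>M)"
    by (subst nn_integral_cmult) auto
  also have "(\<integral>\<^sup>+ t. epowr (avg h t) (P - 1) * h t \<partial>M) \<le> ennreal (avg_bound P + 1) * H"
    unfolding H_def using P by (intro nn_integral_avg_times_le) auto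
  also have "ennreal (2 powr Q) * (epowr C Q * epowr H ((Q - P) / P) * (ennreal (avg_bound P + 1) * H))
      = ennreal (2 powr Q * (avg_bound P + 1)) * epowr C Q * (epowr H ((Q - P) / P) * H)"
    by (subst ennreal_mult) (auto simp: mult_ac)
  also have "epowr H ((Q - P) / P) * H = epowr H (Q / P)"
    using epowr_add[of H "(Q - P) / P" 1] P by (simp add: diff_divide_distrib)
  finally show ?thesis by (simp add: mult_left_mono H_def)
qed

text \<open>Hoelder's inequality with exponents \<open>P/Q\<close> and \<open>R/Q\<close> against the weight \<open>V = mass\<^bsup>Q-1\<^esup> tail\<close>,
  whose power \<open>V\<^bsup>R/Q\<^esup>\<close> is the integrand of the test quantity.\<close>
lemma hardy_upper_gt:
  assumes [measurable]: "h \<in> borel_measurable M" and P: "1 < Q" "Q < P" and R: "1 / R = 1 / Q - 1 / P"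
  shows "(\<integral>\<^sup>+ x. w x * epowr (hardy h x) Q \<partial>N)
    \<le> ennreal (2 powr Q * (avg_bound P powr (Q / P) + 1))
      * epowr (\<integral>\<^sup>+ t. epowr (tail t) (R / Q) * epowr (mass t) (R * (1 - 1 / Q)) \<partial>M) (Q / R)
      * epowr (\<integral>\<^sup>+ t. epowr (h t) P \<partial>M) (Q / P)"
proof -
  define H where "H = (\<integral>\<^sup>+ t. epowr (h t) P \<partial>M)"
  define V where "V t = epowr (mass t) (Q - 1) * tail t" for t
  define I where "I = (\<integral>\<^sup>+ t. epowr (tail t) (R / Q) * epowr (mass t) (R * (1 - 1 / Q)) \<partial>M)"
  have [measurable]: "V \<in> borel_measurable M" unfolding V_def by measurable
  have Req: "R = P * Q / (P - Q)" using R P by (rule gap_exponent_unique)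
  have pow: "(\<integral>\<^sup>+ t. epowr (f t) Q * V t \<partial>M) \<le> epowr (\<integral>\<^sup>+ t. epowr (f t) P \<partial>M) (Q / P) * epowr I (Q / R)"
    if [measurable]: "f \<in> borel_measurable M" for f
  proof -
    have V: "epowr (V t) (R / Q) = epowr (tail t) (R / Q) * epowr (mass t) (R * (1 - 1 / Q))" for t
    proof -
      have "(Q - 1) * (R / Q) = R * (1 - 1 / Q)" using P by (simp add: field_simps)
      then show ?thesis unfolding V_def by (simp only: epowr_mult epowr_epowr mult.commute)
    qed
    have "(\<integral>\<^sup>+ t. epowr (f t) Q * V t \<partial>M)
      \<le> epowr (\<integral>\<^sup>+ t. epowr (epowr (f t) Q) (P / Q) \<partial>M) (1 / (P / Q))
        * epowr (\<integral>\<^sup>+ t. epowr (V t) (R / Q) \<partial>M) (1 / (R / Q))"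
      using P by (intro Holder_nn_integral) (auto simp: Req field_simps)
    then show ?thesis using P by (simp add: V I_def)
  qed
  have "(\<integral>\<^sup>+ x. w x * epowr (hardy h x) Q \<partial>N)
      \<le> ennreal (2 powr Q) * (\<integral>\<^sup>+ t. epowr (cumul M h t) (Q - 1) * h t * tail t \<partial>M)"
    using P by (intro hardy_power_le) auto
  also have "(\<integral>\<^sup>+ t. epowr (cumul M h t) (Q - 1) * h t * tail t \<partial>M)
      \<le> (\<integral>\<^sup>+ t. epowr (avg h t) Q * V t + epowr (h t) Q * V t \<partial>M)"
  proof (intro nn_integral_mono)
    fix t
    have "epowr (cumul M h t) (Q - 1) * h t * tail t = epowr (avg h t) (Q - 1) * h t * V t"
      by (simp add: cumul_eq_avg[OF assms(1)] epowr_mult V_def mult_ac)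
    also have "\<dots> \<le> (epowr (avg h t) Q + epowr (h t) Q) * V t"
      using P by (intro mult_right_mono epowr_mult_le_add) auto
    finally show "epowr (cumul M h t) (Q - 1) * h t * tail t
        \<le> epowr (avg h t) Q * V t + epowr (h t) Q * V t" by (simp add: distrib_right)
  qed
  also have "\<dots> = (\<integral>\<^sup>+ t. epowr (avg h t) Q * V t \<partial>M) + (\<integral>\<^sup>+ t. epowr (h t) Q * V t \<partial>M)"
    by (intro nn_integral_add) auto
  also have "\<dots> \<le> epowr (ennreal (avg_bound P) * H) (Q / P) * epowr I (Q / R) + epowr H (Q / P) * epowr I (Q / R)"
  proof (intro add_mono)
    have "(\<integral>\<^sup>+ t. epowr (avg h t) Q * V t \<partial>M) \<le> epowr (\<integral>\<^sup>+ t. epowr (avg h t) P \<partial>M) (Q / P) * epowr I (Q / R)"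
      by (rule pow) measurable
    also have "\<dots> \<le> epowr (ennreal (avg_bound P) * H) (Q / P) * epowr I (Q / R)"
      unfolding H_def using P
      by (intro mult_right_mono epowr_mono nn_integral_avg_le) auto
    finally show "(\<integral>\<^sup>+ t. epowr (avg h t) Q * V t \<partial>M) \<le> \<dots>" .
    show "(\<integral>\<^sup>+ t. epowr (h t) Q * V t \<partial>M) \<le> epowr H (Q / P) * epowr I (Q / R)"
      unfolding H_def by (rule pow) measurable
  qed
  also have "\<dots> = ennreal (avg_bound P powr (Q / P) + 1) * epowr I (Q / R) * epowr H (Q / P)"
    by (simp add: epowr_mult epowr_ennreal algebra_simps)
  finally show ?thesis
    by (simp add: mult_left_mono ennreal_mult mult.assoc H_def I_def)
qed

text \<open>Test with the indicator of \<open>{..t}\<close>: its image is at least \<open>mass t\<close> on \<open>{x. t \<lhd> x}\<close>.\<close>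
lemma hardy_lower_le:
  assumes P: "1 < P" "1 < Q"
    and C: "\<And>h. h \<in> borel_measurable M \<Longrightarrow> epowr (\<integral>\<^sup>+ x. w x * epowr (hardy h x) Q \<partial>N) (1 / Q)
      \<le> C * epowr (\<integral>\<^sup>+ t. epowr (h t) P \<partial>M) (1 / P)"
  shows "epowr (mass t) (1 - 1 / P) * epowr (tail t) (1 / Q) \<le> C"
proof -
  have "epowr (mass t) Q * tail t = (\<integral>\<^sup>+ x. w x * epowr (mass t * indicator {x. t \<lhd> x} x) Q \<partial>N)"
    unfolding tail_def
    by (subst nn_integral_cmult[symmetric])
      (auto intro!: nn_integral_cong simp: mult.commute split: split_indicator)
  also have "\<dots> \<le> (\<integral>\<^sup>+ x. w x * epowr (hardy (indicator {..t}) x) Q \<partial>N)"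
  proof (intro nn_integral_mono mult_left_mono epowr_mono)
    fix x
    show "mass t * indicator {x. t \<lhd> x} x \<le> hardy (indicator {..t}) x"
      unfolding hardy_def cumul_def using rel_down[of _ t x]
      by (auto split: split_indicator intro!: nn_integral_mono)
  qed (use P in auto)
  finally have "epowr (epowr (mass t) Q * tail t) (1 / Q)
      \<le> epowr (\<integral>\<^sup>+ x. w x * epowr (hardy (indicator {..t}) x) Q \<partial>N) (1 / Q)"
    using P by (intro epowr_mono) auto
  also have "\<dots> \<le> C * epowr (\<integral>\<^sup>+ s. epowr (indicator {..t} s) P \<partial>M) (1 / P)"
    by (rule C) measurable
  also have "(\<integral>\<^sup>+ s. epowr (indicator {..t} s) P \<partial>M) = mass t"
    unfolding cumul_def by (intro nn_integral_cong) (auto split: split_indicator)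
  finally have "mass t * epowr (tail t) (1 / Q) \<le> C * epowr (mass t) (1 / P)"
    using P by (simp add: epowr_mult)
  then have "mass t * epowr (tail t) (1 / Q) * epowr (mass t) (- (1 / P))
      \<le> C * epowr (mass t) (1 / P) * epowr (mass t) (- (1 / P))"
    by (rule mult_right_mono) simp
  also have "\<dots> \<le> C"
    using mult_left_mono[OF epowr_mult_minus_le_1[OF mass_less_top], of C t "1 / P"]
    by (simp add: mult.assoc)
  finally show ?thesis
    using epowr_add[of "mass t" 1 "- (1 / P)"] by (simp add: mult_ac)
qed

text \<open>The test function \<open>h = tail\<^sup>b mass\<^sup>\<delta>\<close>, with \<open>b = R/(PQ)\<close> and \<open>\<delta> = R/(PQ')\<close>, is chosen so that
  \<open>h\<^sup>P\<close> is the integrand of the test quantity \<open>I\<close>. As the tail is antitone, the distribution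
  function of \<open>h\<close> is at least a multiple of \<open>tail\<^sup>b mass\<^bsup>\<delta>+1\<^esup>\<close>, and then \<open>G\<^bsup>Q-1\<^esup> h tail\<close> dominates a
  multiple of the same integrand. The resulting bound of \<open>I\<close> by its power \<open>Q/P\<close> can only be solved
  for finite \<open>I\<close>. Therefore the tail is cut off at \<open>n\<close>.\<close>
lemma hardy_lower_gt:
  assumes P: "1 < Q" "Q < P" and R: "1 / R = 1 / Q - 1 / P"
    and C: "\<And>h. h \<in> borel_measurable M \<Longrightarrow> epowr (\<integral>\<^sup>+ x. w x * epowr (hardy h x) Q \<partial>N) (1 / Q)
      \<le> C * epowr (\<integral>\<^sup>+ t. epowr (h t) P \<partial>M) (1 / P)"
  shows "epowr (\<integral>\<^sup>+ t. epowr (tail t) (R / Q) * epowr (mass t) (R * (1 - 1 / Q)) \<partial>M) (1 / R)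
    \<le> ennreal (2 powr ((R * (Q - 1) / (P * Q) + 1) * (Q - 1) / Q)) * C"
proof -
  define b where "b = R / (P * Q)"
  define \<delta> where "\<delta> = R * (Q - 1) / (P * Q)"
  define e where "e = (\<delta> + 1) * (Q - 1)"
  have Req: "R = P * Q / (P - Q)" using R P by (rule gap_exponent_unique)
  have "0 < R" using P by (simp add: Req)
  then have pos: "0 < R" "0 < b" "0 < \<delta>"
    using P by (simp_all add: b_def \<delta>_def)
  have frac: "b = 1 / (P - Q)" "\<delta> = (Q - 1) / (P - Q)" "R / Q = P / (P - Q)"
      "R * (1 - 1 / Q) = P * (Q - 1) / (P - Q)" "Q / R = (P - Q) / P"
    using P by (simp_all add: Req b_def \<delta>_def divide_simps)
  have exps: "b * P = R / Q" "\<delta> * P = R * (1 - 1 / Q)" "b * (Q - 1) + b + 1 = R / Q"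
      "(\<delta> + 1) * (Q - 1) + \<delta> = R * (1 - 1 / Q)" "1 - Q / P = Q / R"
    unfolding frac using P by (auto simp: divide_simps) (auto simp: algebra_simps)
  define I where "I n = (\<integral>\<^sup>+ t. epowr (min (tail t) (of_nat n)) (R / Q) * epowr (mass t) (R * (1 - 1 / Q)) \<partial>M)"
    for n
  have "epowr (I n) (1 / R) \<le> ennreal (2 powr (e / Q)) * C" for n
  proof -
    define T where "T t = min (tail t) (of_nat n)" for t
    have [measurable]: "T \<in> borel_measurable M" unfolding T_def by measurable
    define h where "h t = epowr (T t) b * epowr (mass t) \<delta>" for t
    have [measurable]: "h \<in> borel_measurable M" unfolding h_def by measurable
    have h_norm: "(\<integral>\<^sup>+ t. epowr (h t) P \<partial>M) = I n"
      by (simp add: h_def I_def T_def epowr_mult exps)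
    have fin: "I n < top"
    proof -
      have "I n \<le> (\<integral>\<^sup>+ t. epowr (of_nat n) (R / Q) * epowr (emeasure M (space M)) (R * (1 - 1 / Q)) \<partial>M)"
        unfolding I_def
      proof (intro nn_integral_mono mult_mono epowr_mono)
        fix t
        have "mass t \<le> (\<integral>\<^sup>+ s. 1 \<partial>M)"
          unfolding cumul_def by (intro nn_integral_mono) (auto split: split_indicator)
        then show "mass t \<le> emeasure M (space M)" by simp
      qed (use P pos in auto)
      also have "\<dots> < top"
        by (simp add: less_top[symmetric] ennreal_mult_eq_top_iff)
      finally show ?thesis .
    qed
    have "I n = (\<integral>\<^sup>+ t. epowr (T t) (R / Q) * epowr (mass t) (R * (1 - 1 / Q)) \<partial>M)"
      by (simp add: I_def T_def)
    also have "\<dots> \<le> (\<integral>\<^sup>+ t. ennreal (2 powr e) * (epowr (cumul M h t) (Q - 1) * h t * tail t) \<partial>M)"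
    proof (intro nn_integral_mono)
      fix t
      have "epowr (mass t) (\<delta> + 1) \<le> ennreal (2 powr (\<delta> + 1)) * (\<integral>\<^sup>+ s \<in> {..t}. epowr (mass s) \<delta> * 1 \<partial>M)"
        unfolding cumul_def[of M "\<lambda>_. 1" t] using pos by (intro epowr_nn_integral_le) auto
      then have "epowr (T t) b * epowr (mass t) (\<delta> + 1)
          \<le> epowr (T t) b * (ennreal (2 powr (\<delta> + 1)) * (\<integral>\<^sup>+ s \<in> {..t}. epowr (mass s) \<delta> \<partial>M))"
        by (intro mult_left_mono) auto
      also have "\<dots> = ennreal (2 powr (\<delta> + 1)) * (\<integral>\<^sup>+ s. epowr (T t) b * (epowr (mass s) \<delta> * indicator {..t} s) \<partial>M)"
        by (subst nn_integral_cmult) (auto simp: mult_ac)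
      also have "(\<integral>\<^sup>+ s. epowr (T t) b * (epowr (mass s) \<delta> * indicator {..t} s) \<partial>M) \<le> cumul M h t"
        unfolding cumul_def[of M h] h_def T_def using pos tail_antimono
        by (intro nn_integral_mono)
           (auto split: split_indicator intro!: mult_right_mono epowr_mono min.mono)
      finally have "epowr (epowr (T t) b * epowr (mass t) (\<delta> + 1)) (Q - 1)
          \<le> epowr (ennreal (2 powr (\<delta> + 1)) * cumul M h t) (Q - 1)"
        using P by (intro epowr_mono) (auto simp: mult_left_mono)
      then have le: "epowr (T t) (b * (Q - 1)) * epowr (mass t) ((\<delta> + 1) * (Q - 1))
          \<le> ennreal (2 powr e) * epowr (cumul M h t) (Q - 1)"
        by (simp add: epowr_mult epowr_ennreal powr_powr e_def)
      have "epowr (T t) (R / Q) * epowr (mass t) (R * (1 - 1 / Q))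
          = epowr (T t) (b * (Q - 1)) * epowr (mass t) ((\<delta> + 1) * (Q - 1)) * h t * T t"
        unfolding exps(3)[symmetric] exps(4)[symmetric] epowr_add h_def by (simp add: mult_ac)
      also have "\<dots> \<le> ennreal (2 powr e) * epowr (cumul M h t) (Q - 1) * h t * tail t"
        by (intro mult_mono le) (auto simp: T_def)
      finally show "epowr (T t) (R / Q) * epowr (mass t) (R * (1 - 1 / Q))
          \<le> ennreal (2 powr e) * (epowr (cumul M h t) (Q - 1) * h t * tail t)"
        by (simp add: mult.assoc)
    qed
    also have "\<dots> = ennreal (2 powr e) * (\<integral>\<^sup>+ t. epowr (cumul M h t) (Q - 1) * h t * tail t \<partial>M)"
      by (subst nn_integral_cmult) auto
    also have "(\<integral>\<^sup>+ t. epowr (cumul M h t) (Q - 1) * h t * tail t \<partial>M)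
        \<le> (\<integral>\<^sup>+ x. w x * epowr (hardy h x) Q \<partial>N)"
      using P by (intro hardy_power_ge) auto
    also have "\<dots> \<le> epowr (C * epowr (I n) (1 / P)) Q"
    proof -
      have "epowr (\<integral>\<^sup>+ x. w x * epowr (hardy h x) Q \<partial>N) (1 / Q) \<le> C * epowr (I n) (1 / P)"
        using C[of h] by (simp add: h_norm)
      then show ?thesis using P by (subst (asm) le_epowr_iff) auto
    qed
    finally have "I n \<le> ennreal (2 powr e) * epowr (C * epowr (I n) (1 / P)) Q"
      by (simp add: mult_left_mono)
    then have "I n \<le> ennreal (2 powr e) * epowr C Q * epowr (I n) (Q / P)"
      by (simp add: epowr_mult mult.assoc)
    from epowr_cancel[OF this fin]
    have "epowr (I n) (Q / R) \<le> ennreal (2 powr e) * epowr C Q" by (simp add: exps)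
    then have "epowr (epowr (I n) (Q / R)) (1 / Q) \<le> epowr (ennreal (2 powr e) * epowr C Q) (1 / Q)"
      using P by (intro epowr_mono) auto
    then show ?thesis using P by (simp add: epowr_mult epowr_ennreal powr_powr)
  qed
  moreover have "epowr (\<integral>\<^sup>+ t. epowr (tail t) (R / Q) * epowr (mass t) (R * (1 - 1 / Q)) \<partial>M) (1 / R)
      = (SUP n. epowr (I n) (1 / R))"
  proof -
    have "epowr (tail t) (R / Q) * epowr (mass t) (R * (1 - 1 / Q))
        = (SUP n. epowr (min (tail t) (of_nat n)) (R / Q) * epowr (mass t) (R * (1 - 1 / Q)))" for t
      using pos P by (simp add: SUP_min_of_nat flip: SUP_mult_right_ennreal epowr_SUP)
    then have "(\<integral>\<^sup>+ t. epowr (tail t) (R / Q) * epowr (mass t) (R * (1 - 1 / Q)) \<partial>M)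
      = (\<integral>\<^sup>+ t. (SUP n. epowr (min (tail t) (of_nat n)) (R / Q) * epowr (mass t) (R * (1 - 1 / Q))) \<partial>M)"
      by simp
    also have "\<dots> = (SUP n. I n)"
      unfolding I_def using pos P
      by (intro nn_integral_monotone_convergence_SUP)
         (auto simp: incseq_def le_fun_def intro!: mult_right_mono epowr_mono min.mono of_nat_mono)
    finally show ?thesis using pos by (simp add: epowr_SUP)
  qed
  ultimately show ?thesis by (auto simp: e_def \<delta>_def intro!: SUP_least)
qed

end

section \<open>Duality\<close>

text \<open>The operator with the transposed kernel obeys the same bound. Pair its value \<open>f\<close> with the
  extremal function \<open>f\<^bsup>P'-1\<^esup>\<close>, cut off at \<open>n\<close> so that its norm is finite. The lemma is symmetric, so it
  gives both inequalities between the two optimal constants.\<close>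
lemma Lp_norm_operator_dual:
  assumes fin: "finite_measure M" "finite_measure N"
    and k [measurable]: "case_prod k \<in> borel_measurable (N \<Otimes>\<^sub>M M)"
    and g [measurable]: "g \<in> borel_measurable N"
    and P: "1 < P" "1 / P + 1 / P' = 1" and Q: "1 < Q" "1 / Q + 1 / Q' = 1"
    and bound: "\<And>h. h \<in> borel_measurable M \<Longrightarrow>
      Lp_norm N Q (\<lambda>x. \<integral>\<^sup>+ t. k x t * h t \<partial>M) \<le> C * Lp_norm M P h"
  shows "Lp_norm M P' (\<lambda>t. \<integral>\<^sup>+ x. k x t * g x \<partial>N) \<le> C * Lp_norm N Q' g"
proof -
  interpret M: finite_measure M by fact
  interpret N: finite_measure N by fact
  interpret pair_sigma_finite M N
    by (simp add: pair_sigma_finite_def M.sigma_finite_measure_axioms N.sigma_finite_measure_axioms)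
  have k' [measurable]: "(\<lambda>(t, x). k x t) \<in> borel_measurable (M \<Otimes>\<^sub>M N)"
    using measurable_compose[OF measurable_pair_swap' k] by (simp add: split_beta')
  have P'eq: "1 / P' = 1 - 1 / P" using P(2) by simp
  then have "P' = 1 / (1 - 1 / P)" by (simp flip: P'eq)
  then have P': "P' = P / (P - 1)" using P(1) by (simp add: field_simps)
  then have P'_gt: "1 < P'" using P(1) by (simp add: less_divide_eq)
  define f where "f t = (\<integral>\<^sup>+ x. k x t * g x \<partial>N)" for t
  have [measurable]: "f \<in> borel_measurable M" unfolding f_def by measurable
  define X where "X n = (\<integral>\<^sup>+ t. epowr (min (f t) (of_nat n)) P' \<partial>M)" for n
  have "epowr (X n) (1 / P') \<le> C * Lp_norm N Q' g" for n
  proof -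
    define h where "h t = epowr (min (f t) (of_nat n)) (P' - 1)" for t
    have [measurable]: "h \<in> borel_measurable M" unfolding h_def by measurable
    have "X n \<le> (\<integral>\<^sup>+ t. epowr (of_nat n) P' \<partial>M)"
      unfolding X_def using P'_gt by (intro nn_integral_mono epowr_mono) auto
    also have "\<dots> < top" by (simp add: less_top[symmetric] ennreal_mult_eq_top_iff)
    finally have fin: "X n < top" .
    have "X n \<le> (\<integral>\<^sup>+ t. f t * h t \<partial>M)"
      unfolding X_def
    proof (intro nn_integral_mono)
      fix t
      have "epowr (min (f t) (of_nat n)) P' = min (f t) (of_nat n) * h t"
        using epowr_add[of "min (f t) (of_nat n)" 1 "P' - 1"] by (simp add: h_def)
      also have "\<dots> \<le> f t * h t" by (intro mult_right_mono) auto
      finally show "epowr (min (f t) (of_nat n)) P' \<le> f t * h t" .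
    qed
    also have "\<dots> = (\<integral>\<^sup>+ t. \<integral>\<^sup>+ x. h t * (k x t * g x) \<partial>N \<partial>M)"
      unfolding f_def by (intro nn_integral_cong, subst nn_integral_cmult) (auto simp: mult.commute)
    also have "\<dots> = (\<integral>\<^sup>+ x. \<integral>\<^sup>+ t. h t * (k x t * g x) \<partial>M \<partial>N)"
      by (rule Fubini'[symmetric]) measurable
    also have "\<dots> = (\<integral>\<^sup>+ x. (\<integral>\<^sup>+ t. k x t * h t \<partial>M) * g x \<partial>N)"
      by (intro nn_integral_cong, subst nn_integral_multc[symmetric]) (auto simp: mult_ac)
    also have "\<dots> \<le> Lp_norm N Q (\<lambda>x. \<integral>\<^sup>+ t. k x t * h t \<partial>M) * Lp_norm N Q' g"
      unfolding Lp_norm_def by (intro Holder_nn_integral Q) auto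
    also have "\<dots> \<le> C * Lp_norm M P h * Lp_norm N Q' g"
      by (intro mult_right_mono bound) auto
    also have "Lp_norm M P h = epowr (X n) (1 / P)"
    proof -
      have "(P' - 1) * P = P'" using P(1) by (simp add: P' field_simps)
      then show ?thesis by (simp add: Lp_norm_def h_def X_def)
    qed
    finally have "X n \<le> C * Lp_norm N Q' g * epowr (X n) (1 / P)" by (simp add: mult_ac)
    from epowr_cancel[OF this fin] show ?thesis by (simp add: P'eq)
  qed
  moreover have "Lp_norm M P' f = (SUP n. epowr (X n) (1 / P'))"
  proof -
    have "(\<integral>\<^sup>+ t. epowr (f t) P' \<partial>M) = (\<integral>\<^sup>+ t. (SUP n. epowr (min (f t) (of_nat n)) P') \<partial>M)"
      using P'_gt by (simp add: SUP_min_of_nat flip: epowr_SUP)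
    also have "\<dots> = (SUP n. X n)"
      unfolding X_def using P'_gt
      by (intro nn_integral_monotone_convergence_SUP)
         (auto simp: incseq_def le_fun_def intro!: epowr_mono min.mono of_nat_mono)
    finally show ?thesis using P'_gt by (simp add: Lp_norm_def epowr_SUP)
  qed
  ultimately have "Lp_norm M P' f \<le> C * Lp_norm N Q' g" by (auto intro!: SUP_least)
  then show ?thesis by (simp add: f_def[abs_def])
qed

section \<open>Comparison with Stieltjes measures\<close>

lemma layer_cake: "x = (\<integral>\<^sup>+ u. indicator {0::real..} u * indicator {u. ennreal u < x} u \<partial>lborel)"
proof (cases x)
  case (real r)
  have "(\<integral>\<^sup>+ u. indicator {0::real..} u * indicator {u. ennreal u < x} u \<partial>lborel)
      = (\<integral>\<^sup>+ u. indicator {0..<r} u \<partial>lborel)"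
    using real by (intro nn_integral_cong) (auto split: split_indicator simp: ennreal_less_iff)
  then show ?thesis using real by simp
next
  case top
  have "(of_nat n :: ennreal) \<le> (\<integral>\<^sup>+ u. indicator {0::real..} u \<partial>lborel)" for n :: nat
  proof -
    have "(of_nat n :: ennreal) = (\<integral>\<^sup>+ u. indicator {0..<real n} u \<partial>lborel)"
      by (simp add: ennreal_of_nat_eq_real_of_nat)
    also have "\<dots> \<le> (\<integral>\<^sup>+ u. indicator {0::real..} u \<partial>lborel)"
      by (intro nn_integral_mono) (auto split: split_indicator)
    finally show ?thesis .
  qed
  then have "(SUP n. of_nat n :: ennreal) \<le> (\<integral>\<^sup>+ u. indicator {0::real..} u \<partial>lborel)"
    by (intro SUP_least) auto
  then show ?thesis
    using top by (simp add: ennreal_SUP_of_nat_eq_top top_unique)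
qed

text \<open>An antitone function is a superposition of indicators of its level sets, which are initial
  segments. So a comparison of the two measures on closed initial segments carries over to its integral. On
  general sets, or for other functions, no such comparison is implied.\<close>
lemma nn_integral_antimono_le:
  assumes "real_line_measure A" "real_line_measure B"
    and space: "space B = space A"
    and [measurable]: "a \<in> borel_measurable A" "b \<in> borel_measurable B"
      "f \<in> borel_measurable A" "f \<in> borel_measurable B"
    and anti: "\<And>s t. s \<in> space A \<Longrightarrow> t \<in> space A \<Longrightarrow> s \<le> t \<Longrightarrow> f t \<le> f s"
    and le: "\<And>t. t \<in> space A \<Longrightarrow> cumul A a t \<le> C * cumul B b t"
  shows "(\<integral>\<^sup>+ x. f x * a x \<partial>A) \<le> C * (\<integral>\<^sup>+ x. f x * b x \<partial>B)"
proof -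
  interpret A: real_line_measure A by fact
  interpret B: real_line_measure B by fact
  have cake: "(\<integral>\<^sup>+ x. f x * v x \<partial>M)
      = (\<integral>\<^sup>+ u. indicator {0..} u * (\<integral>\<^sup>+ x \<in> {x. ennreal u < f x}. v x \<partial>M) \<partial>lborel)"
    if M: "real_line_measure M" and [measurable]: "f \<in> borel_measurable M" "v \<in> borel_measurable M"
    for M :: "real measure" and v
  proof -
    interpret M: real_line_measure M by fact
    interpret pair_sigma_finite M lborel
      by (simp add: pair_sigma_finite_def M.sigma_finite_measure_axioms sigma_finite_lborel)
    have "(\<integral>\<^sup>+ x. f x * v x \<partial>M)
        = (\<integral>\<^sup>+ x. \<integral>\<^sup>+ u. indicator {0..} u * indicator {u. ennreal u < f x} u * v x \<partial>lborel \<partial>M)"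
      by (subst nn_integral_multc) (auto simp flip: layer_cake)
    also have "\<dots> = (\<integral>\<^sup>+ u. \<integral>\<^sup>+ x. indicator {0..} u * indicator {u. ennreal u < f x} u * v x \<partial>M \<partial>lborel)"
      by (rule Fubini'[symmetric]) (simp add: indicator_def)
    also have "\<dots> = (\<integral>\<^sup>+ u. indicator {0..} u * (\<integral>\<^sup>+ x \<in> {x. ennreal u < f x}. v x \<partial>M) \<partial>lborel)"
    proof (intro nn_integral_cong)
      fix u
      have "indicator {0..} u * (\<integral>\<^sup>+ x \<in> {x. ennreal u < f x}. v x \<partial>M)
        = (\<integral>\<^sup>+ x. indicator {0..} u * (v x * indicator {x. ennreal u < f x} x) \<partial>M)"
        by (subst nn_integral_cmult) auto
      then show "(\<integral>\<^sup>+ x. indicator {0..} u * indicator {u. ennreal u < f x} u * v x \<partial>M)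
          = indicator {0..} u * (\<integral>\<^sup>+ x \<in> {x. ennreal u < f x}. v x \<partial>M)"
        by (simp add: indicator_def mult_ac)
    qed
    finally show ?thesis .
  qed
  have level: "(\<integral>\<^sup>+ x \<in> {x. ennreal u < f x}. a x \<partial>A) \<le> C * (\<integral>\<^sup>+ x \<in> {x. ennreal u < f x}. b x \<partial>B)" for u
  proof (cases "{x \<in> space A. ennreal u < f x} = {}")
    case True
    then have "(\<integral>\<^sup>+ x \<in> {x. ennreal u < f x}. a x \<partial>A) = (\<integral>\<^sup>+ x. 0 \<partial>A)"
      by (intro nn_integral_cong) auto
    then show ?thesis by simp
  next
    case False
    then obtain t :: "nat \<Rightarrow> real" where t: "incseq t" "range t \<subseteq> {x \<in> space A. ennreal u < f x}"
      and cof: "\<forall>x\<in>{x \<in> space A. ennreal u < f x}. \<exists>n. x \<le> t n"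
      by (rule cofinal_sequence)
    have "(\<integral>\<^sup>+ x \<in> {x. ennreal u < f x}. a x \<partial>A) \<le> (\<integral>\<^sup>+ x. (SUP n. a x * indicator {..t n} x) \<partial>A)"
    proof (intro nn_integral_mono)
      fix x assume x: "x \<in> space A"
      show "a x * indicator {x. ennreal u < f x} x \<le> (SUP n. a x * indicator {..t n} x)"
      proof (cases "ennreal u < f x")
        case True
        then obtain n where "x \<le> t n" using cof x by auto
        then show ?thesis by (intro SUP_upper2[of n]) (auto split: split_indicator)
      qed simp
    qed
    also have "\<dots> = (SUP n. cumul A a (t n))"
      unfolding cumul_def using t(1)
      by (intro nn_integral_monotone_convergence_SUP)
         (auto simp: incseq_def le_fun_def split: split_indicator intro: order_trans)
    also have "\<dots> \<le> C * (\<integral>\<^sup>+ x \<in> {x. ennreal u < f x}. b x \<partial>B)"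
    proof (intro SUP_least)
      fix n
      have tn: "t n \<in> space A" "ennreal u < f (t n)" using t(2) by auto
      then have "cumul A a (t n) \<le> C * cumul B b (t n)" by (intro le)
      also have "cumul B b (t n) \<le> (\<integral>\<^sup>+ x \<in> {x. ennreal u < f x}. b x \<partial>B)"
        unfolding cumul_def using tn anti[of _ "t n"]
        by (intro nn_integral_mono) (auto split: split_indicator simp: space intro: less_le_trans)
      finally show "cumul A a (t n) \<le> C * (\<integral>\<^sup>+ x \<in> {x. ennreal u < f x}. b x \<partial>B)"
        by (simp add: mult_left_mono)
    qed
    finally show ?thesis .
  qed
  have "(\<integral>\<^sup>+ x. f x * a x \<partial>A) = (\<integral>\<^sup>+ u. indicator {0..} u * (\<integral>\<^sup>+ x \<in> {x. ennreal u < f x}. a x \<partial>A) \<partial>lborel)"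
    by (intro cake assms)
  also have "\<dots> \<le> (\<integral>\<^sup>+ u. C * (indicator {0..} u * (\<integral>\<^sup>+ x \<in> {x. ennreal u < f x}. b x \<partial>B)) \<partial>lborel)"
    using level by (intro nn_integral_mono) (auto split: split_indicator)
  also have "\<dots> = C * (\<integral>\<^sup>+ u. indicator {0..} u * (\<integral>\<^sup>+ x \<in> {x. ennreal u < f x}. b x \<partial>B) \<partial>lborel)"
    by (subst nn_integral_cmult) (auto simp: indicator_def)
  also have "\<dots> = C * (\<integral>\<^sup>+ x. f x * b x \<partial>B)"
    by (subst cake) (auto intro: assms)
  finally show ?thesis .
qed

lemma finite_borel_measure_onD:
  assumes "finite_borel_measure_on c d M"
  shows "space M = {c..d}" "sets M = sets (restrict_space borel {c..d})" "real_line_measure M"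
    and "x \<in> {c..d} \<Longrightarrow> cumul M (\<lambda>_. 1) x = ennreal (measure M {c..x})"
proof -
  interpret finite_measure M using assms by (simp add: finite_borel_measure_on_def)
  show sets: "sets M = sets (restrict_space borel {c..d})"
    using assms by (simp add: finite_borel_measure_on_def)
  then show space: "space M = {c..d}"
    using sets_eq_imp_space_eq[OF sets] by (simp add: space_restrict_space)
  have "(\<lambda>x. x) \<in> borel_measurable (restrict_space borel {c..d})"
    by (intro measurable_restrict_space1) simp
  then have "(\<lambda>x. x) \<in> borel_measurable M"
    by (simp add: measurable_cong_sets[OF sets])
  then show "real_line_measure M"
    by (simp add: real_line_measure_def real_line_measure_axioms_def finite_measure_axioms)
  assume x: "x \<in> {c..d}"
  then have "{c..x} \<in> sets M" by (auto simp: sets sets_restrict_space_iff)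
  have "cumul M (\<lambda>_. 1) x = (\<integral>\<^sup>+ s. indicator {c..x} s \<partial>M)"
    unfolding cumul_def by (intro nn_integral_cong) (auto simp: space split: split_indicator)
  also have "\<dots> = emeasure M {c..x}" using \<open>{c..x} \<in> sets M\<close> by simp
  finally show "cumul M (\<lambda>_. 1) x = ennreal (measure M {c..x})" by (simp add: emeasure_eq_measure)
qed

text \<open>The point is the right-continuity of \<open>x \<mapsto> \<mu>([c,x])\<close>, which is that of the distribution function of
  the image of the measure on the whole line.\<close>
lemma cumul_stieltjes_power:
  assumes M: "finite_borel_measure_on c d M" and "0 < \<gamma>" and x: "x \<in> {c..d}"
  defines "S \<equiv> stieltjes_power c d (\<lambda>x. measure M {c..x}) \<gamma>"
  shows "cumul S (\<lambda>_. 1) x = epowr (cumul M (\<lambda>_. 1) x) \<gamma>" "real_line_measure S"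
    "finite_borel_measure_on c d S"
proof -
  note D = finite_borel_measure_onD[OF M]
  interpret M: real_line_measure M by (rule D)
  have sets: "{c..x} \<in> sets M" if "x \<le> d" for x
    using that by (auto simp: D sets_restrict_space_iff)
  have em: "emeasure S {c..x} = ennreal (measure M {c..x} powr \<gamma>)" if "x \<in> {c..d}" for x
    unfolding S_def
  proof (rule emeasure_stieltjes_power)
    show "mono_on {c..d} (\<lambda>x. measure M {c..x})"
      by (intro mono_onI M.finite_measure_mono sets) auto
    fix y assume y: "y \<in> {c..<d}"
    interpret D: finite_borel_measure "distr M borel (\<lambda>x. x)"
      by (intro finite_borel_measure.intro finite_borel_measure_axioms.intro M.finite_measure_distr) auto
    have cdf: "cdf (distr M borel (\<lambda>x. x)) z = measure M {c..z}" if "c \<le> z" "z \<le> d" for z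
    proof -
      have "{..z} \<inter> space M = {c..z}" using that by (auto simp: D)
      then show ?thesis by (simp add: cdf_def measure_distr)
    qed
    have "(cdf (distr M borel (\<lambda>x. x)) \<longlongrightarrow> cdf (distr M borel (\<lambda>x. x)) y) (at_right y)"
      using D.cdf_is_right_cont[of y] by (simp add: continuous_within)
    moreover have "\<forall>\<^sub>F z in at_right y. y < z \<and> z < d"
      using y by (auto simp: eventually_at_right_field)
    then have "\<forall>\<^sub>F z in at_right y. cdf (distr M borel (\<lambda>x. x)) z = measure M {c..z}"
      by eventually_elim (use y in \<open>auto simp: cdf\<close>)
    ultimately have "((\<lambda>x. measure M {c..x}) \<longlongrightarrow> cdf (distr M borel (\<lambda>x. x)) y) (at_right y)"
      by (rule Lim_transform_eventually)
    then show "continuous (at_right y) (\<lambda>x. measure M {c..x})"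
      using y by (simp add: continuous_within cdf)
  qed (use that assms in auto)
  have sets_S: "sets S = sets (restrict_space borel {c..d})"
    unfolding S_def by (rule sets_stieltjes_power)
  have space_S: "space S = {c..d}"
    using sets_eq_imp_space_eq[OF sets_S] by (simp add: space_restrict_space)
  have "emeasure S (space S) \<noteq> \<infinity>"
    using em[of d] x by (simp add: space_S)
  then have "finite_measure S" by (intro finite_measureI) simp
  then show S: "finite_borel_measure_on c d S"
    by (simp add: finite_borel_measure_on_def sets_S)
  show "real_line_measure S" by (rule finite_borel_measure_onD[OF S])
  interpret S: finite_measure S by fact
  show "cumul S (\<lambda>_. 1) x = epowr (cumul M (\<lambda>_. 1) x) \<gamma>"
    using x em[OF x]
    by (simp add: D(4) finite_borel_measure_onD(4)[OF S] epowr_ennreal S.emeasure_eq_measure)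
qed

section \<open>The norm of the weighted Hardy operator\<close>

text \<open>For \<open>Q < P\<close> the exponent collects two losses: \<open>1 - 1/P\<close> from the comparison with the Stieltjes
  measure and the rest from the test function.\<close>
definition lower_factor :: "real \<Rightarrow> real \<Rightarrow> real" where
  "lower_factor P Q = (if P \<le> Q then 1
     else 2 powr - (1 - 1 / P + (gap_exponent P Q * (Q - 1) / (P * Q) + 1) * (Q - 1) / Q))"

definition upper_factor :: "real \<Rightarrow> real \<Rightarrow> real" where
  "upper_factor P Q = (if P \<le> Q then 2 powr Q * (avg_bound P + 1)
     else 2 powr Q * (avg_bound P powr (Q / P) + 1)) powr (1 / Q)"

context weighted_hardy
begin

text \<open>The common form of the two test quantities. In the Copson case \<open>M\<close> is \<open>\<nu>\<close>, the exponents are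
  \<open>Q'\<close> and \<open>P'\<close>, and \<open>1 - 1/Q' = 1/Q\<close>.\<close>
definition test_const :: "real \<Rightarrow> real \<Rightarrow> real \<Rightarrow> real \<Rightarrow> ennreal" where
  "test_const c d P Q =
     (if P \<le> Q
      then (SUP x \<in> {c..d}. epowr (mass x) (1 - 1 / P) * epowr (tail x) (1 / Q))
      else epowr (\<integral>\<^sup>+ x. epowr (tail x) (gap_exponent P Q / Q)
        \<partial>stieltjes_power c d (\<lambda>x. measure M {c..x}) (gap_exponent P Q * (1 - 1 / P)))
        (1 / gap_exponent P Q))"

text \<open>Here \<open>\<gamma> = R (1 - 1/P)\<close> satisfies \<open>\<gamma> - 1 = R (1 - 1/Q)\<close>. On \<open>{..x}\<close> the measure with density
  \<open>mass\<^bsup>\<gamma>-1\<^esup>\<close> has at most the mass \<open>mass(x)\<^sup>\<gamma>\<close>, since \<open>mass\<close> is monotone, and at least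
  \<open>2\<^bsup>-\<gamma>\<^esup> mass(x)\<^sup>\<gamma>\<close>, by the power inequality; and \<open>mass(x)\<^sup>\<gamma>\<close> is the Stieltjes mass.\<close>
lemma stieltjes_tail_integral:
  assumes M: "finite_borel_measure_on c d M" and cd: "c \<le> d"
    and P: "1 < Q" "Q < P" and R: "1 / R = 1 / Q - 1 / P"
  defines "S \<equiv> stieltjes_power c d (\<lambda>x. measure M {c..x}) (R * (1 - 1 / P))"
  defines "I \<equiv> \<integral>\<^sup>+ t. epowr (tail t) (R / Q) * epowr (mass t) (R * (1 - 1 / Q)) \<partial>M"
  shows "I \<le> (\<integral>\<^sup>+ x. epowr (tail x) (R / Q) \<partial>S)"
    and "(\<integral>\<^sup>+ x. epowr (tail x) (R / Q) \<partial>S) \<le> ennreal (2 powr (R * (1 - 1 / P))) * I"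
proof -
  have Req: "R = P * Q / (P - Q)" using R P by (rule gap_exponent_unique)
  define \<gamma> where "\<gamma> = R * (1 - 1 / P)"
  have pos: "0 < R" using P by (simp add: Req)
  have \<gamma>: "R * (1 - 1 / Q) = \<gamma> - 1"
  proof -
    have "\<gamma> - R * (1 - 1 / Q) = R * (1 / R)" unfolding R \<gamma>_def by (simp add: algebra_simps)
    then show ?thesis using pos by simp
  qed
  have "0 < R * (1 - 1 / Q)" using P pos by (intro mult_pos_pos) auto
  then have \<gamma>_pos: "1 < \<gamma>" by (simp add: \<gamma>)
  note D = finite_borel_measure_onD[OF M]
  have S_cumul: "cumul S (\<lambda>_. 1) x = epowr (mass x) \<gamma>" if "x \<in> {c..d}" for x
    unfolding S_def \<gamma>_def using \<gamma>_pos that by (intro cumul_stieltjes_power M) (auto simp: \<gamma>_def)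
  have S: "real_line_measure S" "finite_borel_measure_on c d S"
    unfolding S_def using \<gamma>_pos cd
    by (auto simp: \<gamma>_def intro!: cumul_stieltjes_power(2,3)[OF M, of _ c])
  note DS = finite_borel_measure_onD[OF S(2)]
  have [measurable_cong]: "sets S = sets M" by (simp add: D DS)
  have [measurable]: "tail \<in> borel_measurable S" by measurable
  have anti: "epowr (tail t) (R / Q) \<le> epowr (tail s) (R / Q)" if "s \<le> t" for s t
    using pos P that by (intro epowr_mono tail_antimono) auto
  have "I \<le> 1 * (\<integral>\<^sup>+ x. epowr (tail x) (R / Q) * 1 \<partial>S)"
    unfolding I_def
  proof (intro nn_integral_antimono_le[OF real_line_measure_axioms S(1)] anti)
    fix t assume t: "t \<in> space M"
    have "cumul M (\<lambda>t. epowr (mass t) (R * (1 - 1 / Q))) t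
        \<le> (\<integral>\<^sup>+ s. epowr (mass t) (\<gamma> - 1) * (1 * indicator {..t} s) \<partial>M)"
      unfolding \<gamma> cumul_def[of M "\<lambda>t. epowr (mass t) (\<gamma> - 1)"] using \<gamma>_pos
      by (intro nn_integral_mono) (auto split: split_indicator intro!: epowr_mono cumul_mono)
    also have "\<dots> = epowr (mass t) (\<gamma> - 1) * mass t"
      unfolding cumul_def[of M "\<lambda>_. 1" t] by (subst nn_integral_cmult) auto
    also have "\<dots> = epowr (mass t) \<gamma>"
      using epowr_add[of "mass t" "\<gamma> - 1" 1] by simp
    finally show "cumul M (\<lambda>t. epowr (mass t) (R * (1 - 1 / Q))) t \<le> 1 * cumul S (\<lambda>_. 1) t"
      using t by (simp add: S_cumul D)
  qed (auto simp: D DS)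
  then show "I \<le> (\<integral>\<^sup>+ x. epowr (tail x) (R / Q) \<partial>S)" by simp
  have "(\<integral>\<^sup>+ x. epowr (tail x) (R / Q) * 1 \<partial>S) \<le> ennreal (2 powr \<gamma>) * I"
    unfolding I_def
  proof (intro nn_integral_antimono_le[OF S(1) real_line_measure_axioms] anti)
    fix t assume t: "t \<in> space S"
    have "epowr (mass t) (\<gamma> - 1 + 1) \<le> ennreal (2 powr (\<gamma> - 1 + 1)) * (\<integral>\<^sup>+ s \<in> {..t}. epowr (mass s) (\<gamma> - 1) * 1 \<partial>M)"
      unfolding cumul_def[of M "\<lambda>_. 1" t] using \<gamma>_pos by (intro epowr_nn_integral_le) auto
    then show "cumul S (\<lambda>_. 1) t \<le> ennreal (2 powr \<gamma>) * cumul M (\<lambda>t. epowr (mass t) (R * (1 - 1 / Q))) t"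
      using t by (simp add: S_cumul DS \<gamma> cumul_def[of M "\<lambda>t. epowr (mass t) (\<gamma> - 1)"])
  qed (auto simp: D DS)
  then show "(\<integral>\<^sup>+ x. epowr (tail x) (R / Q) \<partial>S) \<le> ennreal (2 powr (R * (1 - 1 / P))) * I"
    by (simp add: \<gamma>_def)
qed

lemma hardy_le_test_const:
  assumes M: "finite_borel_measure_on c d M" and cd: "c \<le> d" and P: "1 < P" "1 < Q"
    and h [measurable]: "h \<in> borel_measurable M"
  shows "epowr (\<integral>\<^sup>+ x. w x * epowr (hardy h x) Q \<partial>N) (1 / Q)
    \<le> ennreal (upper_factor P Q) * test_const c d P Q * Lp_norm M P h"
proof (cases "P \<le> Q")
  case True
  have "epowr (\<integral>\<^sup>+ x. w x * epowr (hardy h x) Q \<partial>N) (1 / Q)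
      \<le> epowr (ennreal (2 powr Q * (avg_bound P + 1)) * epowr (test_const c d P Q) Q
        * epowr (\<integral>\<^sup>+ t. epowr (h t) P \<partial>M) (Q / P)) (1 / Q)"
  proof (intro epowr_mono hardy_upper_le)
    fix t assume "t \<in> space M"
    then show "epowr (mass t) (1 - 1 / P) * epowr (tail t) (1 / Q) \<le> test_const c d P Q"
      using True by (auto simp: test_const_def finite_borel_measure_onD[OF M] intro: SUP_upper)
  qed (use P True in auto)
  also have "\<dots> = ennreal (upper_factor P Q) * test_const c d P Q * Lp_norm M P h"
    using P True by (simp add: epowr_mult epowr_ennreal upper_factor_def Lp_norm_def)
  finally show ?thesis .
next
  case False
  define R where "R = gap_exponent P Q"
  have R: "1 / R = 1 / Q - 1 / P" by (simp add: R_def inverse_gap_exponent)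
  have "1 / Q - 1 / P > 0" using P False by (simp add: field_simps)
  then have "0 < R" unfolding R[symmetric] by simp
  define J where "J = (\<integral>\<^sup>+ x. epowr (tail x) (R / Q)
    \<partial>stieltjes_power c d (\<lambda>x. measure M {c..x}) (R * (1 - 1 / P)))"
  have "epowr (\<integral>\<^sup>+ x. w x * epowr (hardy h x) Q \<partial>N) (1 / Q)
      \<le> epowr (ennreal (2 powr Q * (avg_bound P powr (Q / P) + 1))
        * epowr (\<integral>\<^sup>+ t. epowr (tail t) (R / Q) * epowr (mass t) (R * (1 - 1 / Q)) \<partial>M) (Q / R)
        * epowr (\<integral>\<^sup>+ t. epowr (h t) P \<partial>M) (Q / P)) (1 / Q)"
    using P False by (intro epowr_mono hardy_upper_gt R) auto
  also have "\<dots> \<le> epowr (ennreal (2 powr Q * (avg_bound P powr (Q / P) + 1))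
        * epowr J (Q / R) * epowr (\<integral>\<^sup>+ t. epowr (h t) P \<partial>M) (Q / P)) (1 / Q)"
    unfolding J_def using P False \<open>0 < R\<close>
    by (intro epowr_mono mult_right_mono mult_left_mono stieltjes_tail_integral(1)[OF M cd _ _ R]) auto
  also have "\<dots> = ennreal (upper_factor P Q) * test_const c d P Q * Lp_norm M P h"
    using P False by (simp add: epowr_mult epowr_ennreal upper_factor_def Lp_norm_def test_const_def
        J_def flip: R_def)
  finally show ?thesis .
qed

lemma test_const_le:
  assumes M: "finite_borel_measure_on c d M" and cd: "c \<le> d" and P: "1 < P" "1 < Q"
    and C: "\<And>h. h \<in> borel_measurable M \<Longrightarrow>
      epowr (\<integral>\<^sup>+ x. w x * epowr (hardy h x) Q \<partial>N) (1 / Q) \<le> C * Lp_norm M P h"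
  shows "ennreal (lower_factor P Q) * test_const c d P Q \<le> C"
proof (cases "P \<le> Q")
  case True
  have "epowr (mass x) (1 - 1 / P) * epowr (tail x) (1 / Q) \<le> C" for x
    using P C by (intro hardy_lower_le) (auto simp: Lp_norm_def)
  then show ?thesis using True by (auto simp: lower_factor_def test_const_def intro!: SUP_least)
next
  case False
  define R where "R = gap_exponent P Q"
  have R: "1 / R = 1 / Q - 1 / P" by (simp add: R_def inverse_gap_exponent)
  have "1 / Q - 1 / P > 0" using P False by (simp add: field_simps)
  then have "0 < R" unfolding R[symmetric] by simp
  define J where "J = (\<integral>\<^sup>+ x. epowr (tail x) (R / Q)
    \<partial>stieltjes_power c d (\<lambda>x. measure M {c..x}) (R * (1 - 1 / P)))"
  define I where "I = (\<integral>\<^sup>+ t. epowr (tail t) (R / Q) * epowr (mass t) (R * (1 - 1 / Q)) \<partial>M)"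
  define e where "e = (R * (Q - 1) / (P * Q) + 1) * (Q - 1) / Q"
  have "test_const c d P Q = epowr J (1 / R)"
    using False by (simp add: test_const_def J_def R_def)
  also have "\<dots> \<le> epowr (ennreal (2 powr (R * (1 - 1 / P))) * I) (1 / R)"
    unfolding J_def I_def using P False \<open>0 < R\<close>
    by (intro epowr_mono stieltjes_tail_integral(2)[OF M cd _ _ R]) auto
  also have "\<dots> = ennreal (2 powr (1 - 1 / P)) * epowr I (1 / R)"
    using \<open>0 < R\<close> by (simp add: epowr_mult epowr_ennreal powr_powr)
  also have "epowr I (1 / R) \<le> ennreal (2 powr e) * C"
    unfolding I_def e_def using P False C by (intro hardy_lower_gt R) (auto simp: Lp_norm_def)
  finally have "test_const c d P Q \<le> ennreal (2 powr (1 - 1 / P)) * (ennreal (2 powr e) * C)"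
    by (simp add: mult_left_mono)
  also have "\<dots> = ennreal (2 powr (1 - 1 / P + e)) * C"
    by (simp add: powr_add ennreal_mult mult.assoc)
  finally have "ennreal (lower_factor P Q) * test_const c d P Q
      \<le> ennreal (lower_factor P Q) * (ennreal (2 powr (1 - 1 / P + e)) * C)"
    by (rule mult_left_mono) simp
  also have "\<dots> = ennreal (2 powr - (1 - 1 / P + e) * 2 powr (1 - 1 / P + e)) * C"
    using False by (simp add: lower_factor_def e_def R_def ennreal_mult mult.assoc)
  also have "\<dots> = C" by (simp flip: powr_add)
  finally show ?thesis .
qed

end

section \<open>The Hardy and Copson operators\<close>

lemma hardy_op_bounds:
  assumes P: "1 < P" "1 < Q" and cd: "c < d"
    and M: "finite_borel_measure_on c d \<mu>" and N: "finite_borel_measure_on c d \<nu>"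
  shows "ennreal (lower_factor P Q) * hardy_const P Q c d \<mu> \<nu> \<le> opt_const \<mu> P \<nu> Q (hardy_op c \<mu>)"
    and "opt_const \<mu> P \<nu> Q (hardy_op c \<mu>) \<le> ennreal (upper_factor P Q) * hardy_const P Q c d \<mu> \<nu>"
proof -
  note D = finite_borel_measure_onD[OF M] and E = finite_borel_measure_onD[OF N]
  interpret N: real_line_measure \<nu> by (rule E)
  interpret H: weighted_hardy \<mu> \<nu> "\<lambda>_. 1" "(\<le>)"
  proof (intro weighted_hardy.intro weighted_hardy_axioms.intro D E)
    show "Measurable.pred (borel \<Otimes>\<^sub>M borel) (\<lambda>p::real \<times> real. fst p \<le> snd p)" by measurable
  qed auto
  have op: "H.hardy h x = hardy_op c \<mu> h x" for h x
    unfolding H.hardy_def hardy_op_def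
    by (intro nn_integral_cong) (auto simp: D split: split_indicator)
  have norm: "epowr (\<integral>\<^sup>+ x. 1 * epowr (H.hardy h x) Q \<partial>\<nu>) (1 / Q) = Lp_norm \<nu> Q (hardy_op c \<mu> h)" for h
    by (simp add: op Lp_norm_def)
  have tail: "H.tail x = ennreal (measure \<nu> {x..d})" if "x \<in> {c..d}" for x
  proof -
    have sets: "{x..d} \<in> sets \<nu>" using that by (auto simp: E sets_restrict_space_iff)
    have "H.tail x = (\<integral>\<^sup>+ s. indicator {x..d} s \<partial>\<nu>)"
      unfolding H.tail_def by (intro nn_integral_cong) (auto simp: E split: split_indicator)
    then show ?thesis using sets by (simp add: N.emeasure_eq_measure)
  qed
  have conj: "1 / conj_exponent P = 1 - 1 / P" using P by (simp add: conj_exponent_def field_simps)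
  have const: "H.test_const c d P Q = hardy_const P Q c d \<mu> \<nu>"
  proof (cases "P \<le> Q")
    case True
    then show ?thesis
      by (auto simp: H.test_const_def hardy_const_def Let_def conj tail D(4) epowr_ennreal ennreal_mult
          intro!: SUP_cong)
  next
    case False
    have gap: "gap_exponent P Q / conj_exponent P = gap_exponent P Q * (1 - 1 / P)"
      by (simp flip: conj)
    have space: "space (stieltjes_power c d F \<gamma>) = {c..d}" for F \<gamma>
      using sets_eq_imp_space_eq[OF sets_stieltjes_power] by (simp add: space_restrict_space)
    show ?thesis using False
      by (auto simp: H.test_const_def hardy_const_def Let_def gap tail epowr_ennreal space
          intro!: nn_integral_cong arg_cong2[where f = epowr])
  qed
  show "ennreal (lower_factor P Q) * hardy_const P Q c d \<mu> \<nu> \<le> opt_const \<mu> P \<nu> Q (hardy_op c \<mu>)"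
    unfolding opt_const_def const[symmetric]
    using cd P by (intro Inf_greatest H.test_const_le[OF M]) (auto simp: norm simp del: mult_1)
  show "opt_const \<mu> P \<nu> Q (hardy_op c \<mu>) \<le> ennreal (upper_factor P Q) * hardy_const P Q c d \<mu> \<nu>"
    unfolding opt_const_def const[symmetric]
  proof (intro Inf_lower CollectI ballI)
    fix h :: "real \<Rightarrow> ennreal" assume "h \<in> borel_measurable \<mu>"
    then show "Lp_norm \<nu> Q (hardy_op c \<mu> h) \<le> ennreal (upper_factor P Q) * H.test_const c d P Q * Lp_norm \<mu> P h"
      unfolding norm[symmetric] using cd P by (intro H.hardy_le_test_const[OF M]) auto
  qed
qed

text \<open>The Copson operator has the kernel \<open>k(x,t) = \<omega>(t)\<close> for \<open>x < t\<close>. The transposed operator is the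
  weighted Hardy operator of the strict relation from \<open>\<nu>\<close> to \<open>\<mu>\<close> with weight \<open>\<omega>\<^bsup>P'\<^esup>\<close>, with
  \<open>Q'\<close> and \<open>P'\<close> in place of \<open>P\<close> and \<open>Q\<close>. The two cases of the test quantity and the value of \<open>R\<close>
  are preserved by this change of exponents.\<close>
lemma copson_op_bounds:
  assumes P: "1 < P" "1 < Q" and cd: "c < d"
    and M: "finite_borel_measure_on c d \<mu>" and N: "finite_borel_measure_on c d \<nu>"
    and \<omega>: "\<omega> \<in> borel_measurable (restrict_space borel {c..d})"
  defines "P' \<equiv> conj_exponent P" and "Q' \<equiv> conj_exponent Q"
  shows "ennreal (lower_factor Q' P') * copson_const P Q c d \<mu> \<nu> \<omega> \<le> opt_const \<mu> P \<nu> Q (copson_op d \<mu> \<omega>)"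
    and "opt_const \<mu> P \<nu> Q (copson_op d \<mu> \<omega>) \<le> ennreal (upper_factor Q' P') * copson_const P Q c d \<mu> \<nu> \<omega>"
proof -
  note D = finite_borel_measure_onD[OF M] and E = finite_borel_measure_onD[OF N]
  have [measurable]: "\<omega> \<in> borel_measurable \<mu>"
    using \<omega> by (simp add: measurable_cong_sets[OF D(2)])
  interpret M: real_line_measure \<mu> by (rule D)
  interpret H: weighted_hardy \<nu> \<mu> "\<lambda>t. epowr (\<omega> t) P'" "(<)"
  proof (intro weighted_hardy.intro weighted_hardy_axioms.intro D E)
    show "Measurable.pred (borel \<Otimes>\<^sub>M borel) (\<lambda>p::real \<times> real. fst p < snd p)" by measurable
  qed auto
  have conj: "1 / P' = 1 - 1 / P" "1 / Q' = 1 - 1 / Q" "1 < P'" "1 < Q'"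
    using P by (auto simp: P'_def Q'_def conj_exponent_def field_simps)
  then have exps: "1 / P + 1 / P' = 1" "1 / P' + 1 / P = 1" "1 / Q + 1 / Q' = 1" "1 / Q' + 1 / Q = 1"
    "1 - 1 / Q' = 1 / Q"
    by auto
  define k where "k x t = \<omega> t * indicator {s. x < s} t" for x t :: real
  have k [measurable]: "case_prod k \<in> borel_measurable (\<nu> \<Otimes>\<^sub>M \<mu>)"
    "(\<lambda>(t, x). k x t) \<in> borel_measurable (\<mu> \<Otimes>\<^sub>M \<nu>)"
    unfolding k_def by measurable
  have copson: "copson_op d \<mu> \<omega> h x = (\<integral>\<^sup>+ t. k x t * h t \<partial>\<mu>)"
    if [measurable]: "h \<in> borel_measurable \<mu>" for h x
  proof -
    \<comment> \<open>The truncated expressions converge to the integral with the untruncated weight.\<close>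
    have "(\<integral>\<^sup>+ t. k x t * h t \<partial>\<mu>)
        = (\<integral>\<^sup>+ t. (SUP m::nat. min (\<omega> t) (of_nat m) * h t * indicator {t. x < t} t) \<partial>\<mu>)"
      unfolding k_def by (simp add: SUP_min_of_nat flip: SUP_mult_right_ennreal) (simp add: mult_ac)
    also have "\<dots> = (SUP m::nat. \<integral>\<^sup>+ t. min (\<omega> t) (of_nat m) * h t * indicator {t. x < t} t \<partial>\<mu>)"
      by (intro nn_integral_monotone_convergence_SUP)
         (auto simp: incseq_def le_fun_def intro!: mult_right_mono min.mono of_nat_mono)
    also have "\<dots> = copson_op d \<mu> \<omega> h x"
      unfolding copson_op_def
      by (intro SUP_cong nn_integral_cong) (auto simp: D split: split_indicator)
    finally show ?thesis by simp
  qed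
  have norm: "epowr (\<integral>\<^sup>+ t. epowr (\<omega> t) P' * epowr (H.hardy g t) P' \<partial>\<mu>) (1 / P')
      = Lp_norm \<mu> P' (\<lambda>t. \<integral>\<^sup>+ x. k x t * g x \<partial>\<nu>)"
    if [measurable]: "g \<in> borel_measurable \<nu>" for g
  proof -
    have "(\<integral>\<^sup>+ x. k x t * g x \<partial>\<nu>) = \<omega> t * H.hardy g t" for t
      unfolding H.hardy_def k_def
      by (subst nn_integral_cmult[symmetric]) (auto intro!: nn_integral_cong simp: indicator_def)
    then show ?thesis by (simp add: Lp_norm_def epowr_mult)
  qed
  have tail: "H.tail x = (\<integral>\<^sup>+ t \<in> {x<..d}. epowr (\<omega> t) P' \<partial>\<mu>)" for x
    unfolding H.tail_def by (intro nn_integral_cong) (auto simp: D split: split_indicator)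
  have order: "Q' \<le> P' \<longleftrightarrow> P \<le> Q"
  proof -
    have "Q' \<le> P' \<longleftrightarrow> 1 / P' \<le> 1 / Q'" using conj(3,4) by (auto simp: field_simps)
    also have "\<dots> \<longleftrightarrow> P \<le> Q" unfolding conj using P by (auto simp: field_simps)
    finally show ?thesis .
  qed
  have gap: "gap_exponent Q' P' = gap_exponent P Q"
    unfolding gap_exponent_def conj by simp
  have const: "H.test_const c d Q' P' = copson_const P Q c d \<mu> \<nu> \<omega>"
  proof (cases "P \<le> Q")
    case True
    then show ?thesis
      by (auto simp: H.test_const_def copson_const_def Let_def order tail E(4) exps epowr_ennreal
          simp flip: P'_def intro!: SUP_cong)
  next
    case False
    have "R * (1 - 1 / Q') = R / Q" for R by (simp add: exps)
    then show ?thesis using False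
      by (simp add: H.test_const_def copson_const_def Let_def order tail gap flip: P'_def)
  qed
  have fin: "finite_measure \<mu>" "finite_measure \<nu>"
    using M N by (auto simp: finite_borel_measure_on_def)
  show "ennreal (lower_factor Q' P') * copson_const P Q c d \<mu> \<nu> \<omega> \<le> opt_const \<mu> P \<nu> Q (copson_op d \<mu> \<omega>)"
    unfolding opt_const_def const[symmetric]
  proof (intro Inf_greatest H.test_const_le[OF N])
    fix C and g :: "real \<Rightarrow> ennreal"
    assume C: "C \<in> {C. \<forall>h\<in>borel_measurable \<mu>. Lp_norm \<nu> Q (copson_op d \<mu> \<omega> h) \<le> C * Lp_norm \<mu> P h}"
      and g [measurable]: "g \<in> borel_measurable \<nu>"
    have "Lp_norm \<mu> P' (\<lambda>t. \<integral>\<^sup>+ x. k x t * g x \<partial>\<nu>) \<le> C * Lp_norm \<nu> Q' g"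
    proof (rule Lp_norm_operator_dual[OF fin k(1) g P(1) exps(1) P(2) exps(3)])
      fix h :: "real \<Rightarrow> ennreal" assume "h \<in> borel_measurable \<mu>"
      then show "Lp_norm \<nu> Q (\<lambda>x. \<integral>\<^sup>+ t. k x t * h t \<partial>\<mu>) \<le> C * Lp_norm \<mu> P h"
        using C by (auto simp flip: copson)
    qed
    then show "epowr (\<integral>\<^sup>+ t. epowr (\<omega> t) P' * epowr (H.hardy g t) P' \<partial>\<mu>) (1 / P') \<le> C * Lp_norm \<nu> Q' g"
      by (simp add: norm)
  qed (use cd conj in auto)
  show "opt_const \<mu> P \<nu> Q (copson_op d \<mu> \<omega>) \<le> ennreal (upper_factor Q' P') * copson_const P Q c d \<mu> \<nu> \<omega>"
    unfolding opt_const_def const[symmetric]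
  proof (intro Inf_lower CollectI ballI)
    fix h :: "real \<Rightarrow> ennreal" assume h [measurable]: "h \<in> borel_measurable \<mu>"
    have "Lp_norm \<nu> Q (\<lambda>x. \<integral>\<^sup>+ t. k x t * h t \<partial>\<mu>)
        \<le> ennreal (upper_factor Q' P') * H.test_const c d Q' P' * Lp_norm \<mu> P h"
    proof (rule Lp_norm_operator_dual[OF fin(2,1) k(2) h conj(4) exps(4) conj(3) exps(2)])
      fix g :: "real \<Rightarrow> ennreal" assume [measurable]: "g \<in> borel_measurable \<nu>"
      show "Lp_norm \<mu> P' (\<lambda>t. \<integral>\<^sup>+ x. k x t * g x \<partial>\<nu>)
          \<le> ennreal (upper_factor Q' P') * H.test_const c d Q' P' * Lp_norm \<nu> Q' g"
        using H.hardy_le_test_const[OF N _ conj(4,3), of g] cd by (simp add: norm)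
    qed
    then show "Lp_norm \<nu> Q (copson_op d \<mu> \<omega> h)
        \<le> ennreal (upper_factor Q' P') * H.test_const c d Q' P' * Lp_norm \<mu> P h"
      by (simp add: Lp_norm_def copson[OF h])
  qed
qed

theorem theorem4p4:
  fixes P Q :: real
  assumes "1 < P" and "1 < Q"
  shows "\<exists>k K :: real. 0 < k \<and> k \<le> K \<and>
    (\<forall>(c::real) (d::real) (\<mu>::real measure) (\<nu>::real measure) (\<omega>::real \<Rightarrow> ennreal).
       c < d \<longrightarrow> finite_borel_measure_on c d \<mu> \<longrightarrow> finite_borel_measure_on c d \<nu> \<longrightarrow>
       \<omega> \<in> borel_measurable (restrict_space borel {c..d}) \<longrightarrow>
         ennreal k * hardy_const P Q c d \<mu> \<nu> \<le> opt_const \<mu> P \<nu> Q (hardy_op c \<mu>) \<and>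
         opt_const \<mu> P \<nu> Q (hardy_op c \<mu>) \<le> ennreal K * hardy_const P Q c d \<mu> \<nu> \<and>
         ennreal k * copson_const P Q c d \<mu> \<nu> \<omega> \<le> opt_const \<mu> P \<nu> Q (copson_op d \<mu> \<omega>) \<and>
         opt_const \<mu> P \<nu> Q (copson_op d \<mu> \<omega>) \<le> ennreal K * copson_const P Q c d \<mu> \<nu> \<omega>)"
proof -
  define P' where "P' = conj_exponent P"
  define Q' where "Q' = conj_exponent Q"
  define k where "k = min (lower_factor P Q) (lower_factor Q' P')"
  define K where "K = max k (max (upper_factor P Q) (upper_factor Q' P'))"
  have "0 < k" by (simp add: k_def lower_factor_def)
  have le: "ennreal k * x \<le> ennreal (lower_factor P Q) * x" "ennreal k * x \<le> ennreal (lower_factor Q' P') * x"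
    "ennreal (upper_factor P Q) * x \<le> ennreal K * x" "ennreal (upper_factor Q' P') * x \<le> ennreal K * x"
    for x by (auto simp: k_def K_def intro!: mult_right_mono ennreal_leI)
  show ?thesis
  proof (rule exI[of _ k], rule exI[of _ K], intro conjI allI impI)
    fix c d :: real and \<mu> \<nu> :: "real measure" and \<omega> :: "real \<Rightarrow> ennreal"
    assume J: "c < d" "finite_borel_measure_on c d \<mu>" "finite_borel_measure_on c d \<nu>"
      and \<omega>: "\<omega> \<in> borel_measurable (restrict_space borel {c..d})"
    note hardy = hardy_op_bounds[OF assms J]
    note copson = copson_op_bounds[OF assms J \<omega>, folded P'_def Q'_def]
    show "ennreal k * hardy_const P Q c d \<mu> \<nu> \<le> opt_const \<mu> P \<nu> Q (hardy_op c \<mu>)"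
      by (rule order_trans[OF le(1) hardy(1)])
    show "opt_const \<mu> P \<nu> Q (hardy_op c \<mu>) \<le> ennreal K * hardy_const P Q c d \<mu> \<nu>"
      by (rule order_trans[OF hardy(2) le(3)])
    show "ennreal k * copson_const P Q c d \<mu> \<nu> \<omega> \<le> opt_const \<mu> P \<nu> Q (copson_op d \<mu> \<omega>)"
      by (rule order_trans[OF le(2) copson(1)])
    show "opt_const \<mu> P \<nu> Q (copson_op d \<mu> \<omega>) \<le> ennreal K * copson_const P Q c d \<mu> \<nu> \<omega>"
      by (rule order_trans[OF copson(2) le(4)])
  qed (use \<open>0 < k\<close> in \<open>auto simp: K_def\<close>)
qed

end
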